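(* Let $K$ be a field, $S=K[t_1,\ldots,t_s]$, and let $I=I(L)$ be the matrix ideal associated to an $s\times m$ integer matrix $L$. Let $\mathcal{L}$ be the lattice spanned by the columns of $L$. Suppose that $I$ is homogeneous with respect to a weight vector $\mathbf{d}=(d_1,\ldots,d_s)$ of positive integers with $\gcd(d_1,\ldots,d_s)=1$, and that $V(I,t_i)=\{0\}$ for all $i$. Then $$\deg(S/I)=\max\{d_1,\ldots,d_s\}\,|T(\mathbb{Z}^s/\mathcal{L})|=\max\{d_1,\ldots,d_s\}\,\Delta_{s-1}(L).$$
   Context: For $a\in\mathbb{Z}^s$ write $a=a^+-a^-$ with $a^\pm\in\mathbb{N}^s$ of disjoint support, and $t^c=t_1^{c_1}\cdots t_s^{c_s}$. If $L$ has columns $a_1,\ldots,a_m$, its matrix ideal is $I(L)=(t^{a_1^+}-t^{a_1^-},\ldots,t^{a_m^+}-t^{a_m^-})\subset S$. Homogeneous with respect to $\mathbf{d}$ means homogeneous for the grading of $S$ with $\deg t_i=d_i$. $V(\cdot)$ is the set of common zeros in $K^s$ and $V(I,t_i)=V((I,t_i))$. $T(M)$ is the torsion subgroup of an abelian group $M$. $\Delta_i(L)$ is the greatest common divisor of all the non-zero $i\times i$ minors of $L$. For an ideal $I\subset S$ with $k=\dim(S/I)$ (Krull dimension), the degree is $\deg(S/I)=k!\lim_{i\to\infty}\dim_K(S_{\le i}/I_{\le i})/i^k$, where $S_{\le i}$ (resp. $I_{\le i}$) is the space of polynomials of $S$ (resp. of $I$) of standard total degree at most $i$. *)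

theory Defs
  imports
    "HOL-Library.Poly_Mapping"
    "HOL-Library.Extended_Nat"
    "HOL-Algebra.Algebra"
    "HOL-Analysis.Finite_Cartesian_Product"
    "Jordan_Normal_Form.VS_Connect"
begin

no_notation vec_index (infixl "$" 100)

text \<open>The polynomial ring \<open>K[t\<^sub>1, \<dots>, t\<^sub>s]\<close> is the type of finitely supported maps from exponent
  vectors to coefficients, with the variables indexed by a finite type \<open>'n\<close> (so \<open>s = CARD('n)\<close>).
  Ideals of it are taken in \<^term>\<open>class_ring\<close>, the ring record with carrier \<open>UNIV\<close> and the operations
  of the type.\<close>

type_synonym ('n, 'k) mvpoly = "('n \<Rightarrow>\<^sub>0 nat) \<Rightarrow>\<^sub>0 'k"

definition monom_t :: "('n \<Rightarrow>\<^sub>0 nat) \<Rightarrow> ('n, 'k::field) mvpoly" where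
  "monom_t c = Poly_Mapping.single c 1"

definition var_t :: "'n \<Rightarrow> ('n, 'k::field) mvpoly" where
  "var_t i = monom_t (Poly_Mapping.single i 1)"

definition eval_mv :: "'k ^ 'n \<Rightarrow> ('n::finite, 'k::field) mvpoly \<Rightarrow> 'k" where
  "eval_mv x p = (\<Sum>c\<in>Poly_Mapping.keys p. Poly_Mapping.lookup p c * (\<Prod>i\<in>UNIV. (x $ i) ^ Poly_Mapping.lookup c i))"

definition zero_set :: "('n::finite, 'k::field) mvpoly set \<Rightarrow> ('k ^ 'n) set" where
  "zero_set A = {x. \<forall>p\<in>A. eval_mv x p = 0}"


subsection \<open>Matrix ideals\<close>

text \<open>Truncation by \<^const>\<open>nat\<close> gives \<open>a\<^sup>+ = max a 0\<close> and \<open>a\<^sup>- = max (- a) 0\<close> componentwise.\<close>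

definition pos_part :: "int ^ 'n \<Rightarrow> ('n::finite \<Rightarrow>\<^sub>0 nat)" where
  "pos_part a = Abs_poly_mapping (\<lambda>i. nat (a $ i))"

definition neg_part :: "int ^ 'n \<Rightarrow> ('n::finite \<Rightarrow>\<^sub>0 nat)" where
  "neg_part a = Abs_poly_mapping (\<lambda>i. nat (- (a $ i)))"

definition matrix_ideal :: "int ^ 'm ^ 'n \<Rightarrow> ('n::finite, 'k::field) mvpoly set" where
  "matrix_ideal L =
     Idl\<^bsub>class_ring\<^esub> {monom_t (pos_part a) - monom_t (neg_part a) | a. a \<in> columns L}"


subsection \<open>Gradings\<close>

definition weight :: "('n \<Rightarrow> nat) \<Rightarrow> ('n::finite \<Rightarrow>\<^sub>0 nat) \<Rightarrow> nat" where
  "weight d c = (\<Sum>i\<in>UNIV. d i * Poly_Mapping.lookup c i)"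

definition hom_component ::
  "('n \<Rightarrow> nat) \<Rightarrow> nat \<Rightarrow> ('n::finite, 'k::field) mvpoly \<Rightarrow> ('n, 'k) mvpoly" where
  "hom_component d e p =
     (\<Sum>c\<in>{c \<in> Poly_Mapping.keys p. weight d c = e}. Poly_Mapping.single c (Poly_Mapping.lookup p c))"

definition homogeneous_ideal :: "('n \<Rightarrow> nat) \<Rightarrow> ('n::finite, 'k::field) mvpoly set \<Rightarrow> bool" where
  "homogeneous_ideal d I \<longleftrightarrow> Ideal.ideal I class_ring \<and> (\<forall>p\<in>I. \<forall>e. hom_component d e p \<in> I)"


subsection \<open>Krull dimension and degree\<close>

text \<open>A chain \<open>P\<^sub>0 \<subset> \<dots> \<subset> P\<^sub>n\<close> of prime ideals has length \<open>n\<close>. For the zero ring the supremum is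
  taken over the empty set and the value is \<open>0\<close>.\<close>

definition krull_dim :: "('a, 'b) ring_scheme \<Rightarrow> enat" where
  "krull_dim R = Sup {enat n | n.
     \<exists>P :: nat \<Rightarrow> 'a set. (\<forall>i\<le>n. primeideal (P i) R) \<and> (\<forall>i<n. P i \<subset> P (Suc i))}"

text \<open>The multiplicative fields of a module record play no role. In \<open>quot_module\<close>, the union in
  the scalar multiplication is over representatives \<open>x\<close> of the coset \<open>A\<close>, all of which give the same
  coset of \<open>N\<close> when \<open>N\<close> is a submodule.\<close>

definition mvpoly_module :: "('k::field, ('n, 'k) mvpoly) module" where
  "mvpoly_module = \<lparr>carrier = UNIV, monoid.mult = undefined, one = undefined,
     ring.zero = 0, add = (+), smult = (\<lambda>c p. Poly_Mapping.single 0 c * p)\<rparr>"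

definition quot_module :: "('a, 'b, 'c) module_scheme \<Rightarrow> 'b set \<Rightarrow> ('a, 'b set) module" where
  "quot_module M N = \<lparr>carrier = a_rcosets\<^bsub>M\<^esub> N, monoid.mult = undefined, one = undefined,
     ring.zero = N, add = set_add M, smult = (\<lambda>c A. \<Union>x\<in>A. N +>\<^bsub>M\<^esub> (c \<odot>\<^bsub>M\<^esub> x))\<rparr>"

definition deg_le :: "nat \<Rightarrow> ('n::finite, 'k::field) mvpoly set" where
  "deg_le i = {p. \<forall>c\<in>Poly_Mapping.keys p. weight (\<lambda>_. 1) c \<le> i}"

definition affine_hilbert_fun :: "('n::finite, 'k::field) mvpoly set \<Rightarrow> nat \<Rightarrow> nat" where
  "affine_hilbert_fun I i =
     vectorspace.dim (class_ring :: 'k ring)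
       (quot_module (mvpoly_module\<lparr>carrier := deg_le i\<rparr>) (I \<inter> deg_le i))"

definition quotient_degree :: "('n::finite, 'k::field) mvpoly set \<Rightarrow> real" where
  "quotient_degree I =
     (let k = the_enat (krull_dim (class_ring Quot I))
      in fact k * lim (\<lambda>i. real (affine_hilbert_fun I i) / real i ^ k))"


subsection \<open>Lattices, torsion and minors\<close>

definition Zn_group :: "(int ^ 'n::finite) monoid" where
  "Zn_group = \<lparr>carrier = UNIV, monoid.mult = (+), one = 0\<rparr>"

definition column_lattice :: "int ^ 'm ^ 'n \<Rightarrow> (int ^ 'n::finite) set" where
  "column_lattice L = generate Zn_group (columns L)"

definition torsion_subgroup :: "('a, 'b) monoid_scheme \<Rightarrow> 'a set" where
  "torsion_subgroup G = {x \<in> carrier G. \<exists>n::nat. n > 0 \<and> x [^]\<^bsub>G\<^esub> n = \<one>\<^bsub>G\<^esub>}"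

text \<open>Rows and columns are selected by arbitrary injections \<open>r\<close> and \<open>c\<close> rather than increasing ones,
  as the index types carry no order. Each minor thus appears with both signs if \<open>i \<ge> 2\<close>, which does
  not affect the greatest common divisor. The only \<open>0 \<times> 0\<close> minor is \<open>1\<close>.\<close>

definition minors :: "nat \<Rightarrow> int ^ 'm ^ 'n \<Rightarrow> int set" where
  "minors i L = {Determinant.det (Matrix.mat i i (\<lambda>(k, l). L $ r k $ c l)) | r c.
     inj_on r {..<i} \<and> inj_on c {..<i}}"

definition Delta :: "nat \<Rightarrow> int ^ 'm ^ 'n \<Rightarrow> int" where
  "Delta i L = Gcd {x \<in> minors i L. x \<noteq> 0}"

end

theory Submission
  imports Defs
begin

text \<open>Everything is read off the congruence on \<open>\<nat>\<^sup>s\<close> generated by \<open>u + a\<^sup>+ \<sim> u + a\<^sup>-\<close> for the columns \<open>a\<close> of \<open>L\<close>: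
  the classes of monomials form a basis of \<open>S/I\<close>, and the affine Hilbert function counts the classes
  that contain a monomial of degree at most \<open>i\<close>.  Over any field, pure difference binomials
  that have a common zero with support \<open>F\<close> also vanish at the indicator vector of \<open>F\<close>, so the hypothesis on
  \<open>V(I, t\<^sub>i)\<close> says that every monomial of large weight is congruent to a multiple of each variable.
  Hence multiplication by \<open>t\<^sub>j\<close> from the classes of weight \<open>w\<close> to those of weight \<open>w + d\<^sub>j\<close> is onto,
  so eventually bijective by finiteness. In large weights congruence is then the same as equality
  modulo the lattice, and there are exactly \<open>|T(\<int>\<^sup>s/\<L>)|\<close> classes in each weight. A class of weight \<open>w\<close> has
  minimal degree \<open>w / max d\<^sub>i + O(1)\<close>, which gives the leading coefficient.

  The Krull dimension is at most one because a chain of three primes would produce two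
  elements algebraically independent modulo \<open>I\<close>, hence quadratic growth. For the minors, the
  lattice is completed to full rank by a vector \<open>v\<close> with \<open>d \<cdot> v = 1\<close>; a triangular basis computes both
  its index and the greatest common divisor of the determinants of its \<open>s\<close>-tuples.\<close>

subsection \<open>The congruence on exponents\<close>

text \<open>The obstacle is that I need not be a lattice ideal: a variable may be a zero divisor
  modulo I, so congruence of exponents can be finer than equality modulo the lattice, and the two
  are only known to agree after a common exponent is added (\<open>lat_imp_mcong\<close>).
  Injectivity of the shifts in large weight is what allows that exponent to be cancelled again.
  Finiteness of the torsion group comes out of the same count, since representatives of distinct
  cosets can be translated to incongruent exponents of one weight.

  The field drops out once the locale \<open>no_face\<close> is reached: it keeps a condition on
  supports alone, obtained from points with entries 0 and 1, so no Nullstellensatz is involved. For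
  the minors, a vector v with d . v = 1 links sizes s - 1 and s: the minor that omits row i is, up
  to sign, d_i times the determinant of the same columns together with v, and expansion along v
  writes that determinant through such minors.\<close>

lemma lookup_pos_part [simp]: "Poly_Mapping.lookup (pos_part a) i = nat (a $ i)"
  by (simp add: pos_part_def)

lemma lookup_neg_part [simp]: "Poly_Mapping.lookup (neg_part a) i = nat (- (a $ i))"
  by (simp add: neg_part_def)

section \<open>Weights and induction on exponents\<close>

lemma weight_add: "weight d (b + c) = weight d b + weight d c"
  by (simp add: weight_def lookup_add sum.distrib algebra_simps)

lemma weight_single [simp]: "weight d (Poly_Mapping.single i k) = d i * k"
proof -
  have "weight d (Poly_Mapping.single i k) = (\<Sum>l\<in>UNIV. if l = i then d i * k else 0)"
    unfolding weight_def by (rule sum.cong) (auto simp: lookup_single when_def)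
  then show ?thesis by simp
qed

lemma weight_zero [simp]: "weight d 0 = 0"
  by (simp add: weight_def)

lemma finite_weight_le:
  assumes "\<And>i. d i > 0"
  shows "finite {c. weight d c \<le> w}"
proof -
  have "Poly_Mapping.lookup ` {c. weight d c \<le> w} \<subseteq> (UNIV \<rightarrow>\<^sub>E {..w})"
  proof (clarsimp simp: PiE_def extensional_def)
    fix c :: "'a \<Rightarrow>\<^sub>0 nat" and i assume "weight d c \<le> w"
    moreover have "d i * Poly_Mapping.lookup c i \<le> weight d c"
      unfolding weight_def by (rule member_le_sum) auto
    moreover have "Poly_Mapping.lookup c i \<le> d i * Poly_Mapping.lookup c i"
      using assms[of i] by simp
    ultimately show "Poly_Mapping.lookup c i \<le> w" by linarith
  qed
  then have "finite (Poly_Mapping.lookup ` {c. weight d c \<le> w})"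
    by (rule finite_subset) (simp add: finite_PiE)
  then show ?thesis
    by (rule finite_imageD) (simp add: inj_on_def lookup_inject)
qed

lemma poly_mapping_nat_decomp:
  fixes c :: "'n \<Rightarrow>\<^sub>0 nat"
  assumes "\<And>i. Poly_Mapping.lookup b i \<le> Poly_Mapping.lookup c i"
  obtains u where "c = b + u"
proof
  show "c = b + (c - b)"
    by (rule poly_mapping_eqI) (use assms in \<open>simp add: lookup_add lookup_minus\<close>)
qed

lemma poly_mapping_nat_single_decomp:
  fixes c :: "'n \<Rightarrow>\<^sub>0 nat"
  assumes "k \<le> Poly_Mapping.lookup c j"
  obtains u where "c = Poly_Mapping.single j k + u"
  by (rule poly_mapping_nat_decomp[of "Poly_Mapping.single j k" c])
    (use assms in \<open>auto simp: lookup_single when_def\<close>)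

lemma poly_mapping_nat_induct [case_names zero add]:
  fixes u :: "'n::finite \<Rightarrow>\<^sub>0 nat"
  assumes "P 0" and "\<And>u j. P u \<Longrightarrow> P (u + Poly_Mapping.single j 1)"
  shows "P u"
proof (induction "weight (\<lambda>_. 1) u" arbitrary: u)
  case 0
  have "u = 0"
    by (rule poly_mapping_eqI) (use 0 in \<open>simp add: weight_def\<close>)
  then show ?case using assms(1) by simp
next
  case (Suc m)
  then obtain j where "Poly_Mapping.lookup u j \<noteq> 0"
    by (metis (no_types, lifting) mult_0_right nat.distinct(1) sum.neutral weight_def)
  then obtain v where v: "u = Poly_Mapping.single j 1 + v"
    using poly_mapping_nat_single_decomp[of 1 u j] by (metis One_nat_def Suc_leI neq0_conv)
  then have "weight (\<lambda>_. 1) v = m" using Suc(2) by (simp add: weight_add)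
  then show ?case using assms(2)[OF Suc(1)] v by (simp add: add.commute)
qed

text \<open>The translate \<open>u\<close> is built into \<open>gen\<close>, so the equivalence
  closure is already compatible with addition of exponents (\<open>mcong_add\<close>).\<close>

inductive mcong :: "(int ^ 'n::finite) set \<Rightarrow> ('n \<Rightarrow>\<^sub>0 nat) \<Rightarrow> ('n \<Rightarrow>\<^sub>0 nat) \<Rightarrow> bool" for A where
  refl: "mcong A c c"
| gen: "a \<in> A \<Longrightarrow> mcong A (u + pos_part a) (u + neg_part a)"
| sym: "mcong A b c \<Longrightarrow> mcong A c b"
| trans: "mcong A b c \<Longrightarrow> mcong A c e \<Longrightarrow> mcong A b e"

lemma mcong_add: "mcong A b c \<Longrightarrow> mcong A (b + u) (c + u)"
proof (induction rule: mcong.induct)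
  case (gen a v)
  then show ?case using mcong.gen[of a A "v + u"] by (simp add: ac_simps)
next
  case (trans b c e)
  from mcong.trans[OF trans.IH] show ?case .
next
  case (sym b c)
  from mcong.sym[OF sym.IH] show ?case .
qed (rule mcong.refl)

lemma mcong_add2: "mcong A b c \<Longrightarrow> mcong A b' c' \<Longrightarrow> mcong A (b + b') (c + c')"
  by (rule mcong.trans[OF mcong_add[of A b c b']])
    (simp_all add: mcong_add add.commute[of c])

section \<open>Exponents as integer vectors, and the lattice of differences\<close>

definition ivec :: "('n::finite \<Rightarrow>\<^sub>0 nat) \<Rightarrow> int ^ 'n" where
  "ivec c = (\<chi> i. int (Poly_Mapping.lookup c i))"

lemma ivec_nth [simp]: "ivec c $ i = int (Poly_Mapping.lookup c i)"
  by (simp add: ivec_def)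

lemma ivec_add [simp]: "ivec (b + c) = ivec b + ivec c"
  by (simp add: Finite_Cartesian_Product.vec_eq_iff lookup_add)

lemma ivec_inj: "ivec b = ivec c \<Longrightarrow> b = c"
  by (rule poly_mapping_eqI) (simp add: Finite_Cartesian_Product.vec_eq_iff)

lemma ivec_parts: "ivec (pos_part a) - ivec (neg_part a) = a"
  by (simp add: Finite_Cartesian_Product.vec_eq_iff)

definition dot :: "('n::finite \<Rightarrow> nat) \<Rightarrow> int ^ 'n \<Rightarrow> int" where
  "dot d x = (\<Sum>i\<in>UNIV. int (d i) * x $ i)"

lemma dot_add [simp]: "dot d (x + y) = dot d x + dot d y"
  by (simp add: dot_def sum.distrib algebra_simps)

lemma dot_zero [simp]: "dot d 0 = 0"
  by (simp add: dot_def)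

lemma dot_uminus [simp]: "dot d (- x) = - dot d x"
  by (simp add: dot_def sum_negf)

lemma dot_minus [simp]: "dot d (x - y) = dot d x - dot d y"
  by (simp add: dot_def sum_subtractf algebra_simps)

lemma dot_smult [simp]: "dot d (k *s x) = k * dot d x"
  by (simp add: dot_def sum_distrib_left algebra_simps)

lemma dot_ivec [simp]: "dot d (ivec c) = int (weight d c)"
  by (simp add: dot_def weight_def)

lemma dot_axis: "dot d (axis i 1) = int (d i)"
proof -
  have "dot d (axis i 1) = (\<Sum>l\<in>UNIV. if l = i then int (d i) else 0)"
    unfolding dot_def by (rule sum.cong) (auto simp: axis_def)
  then show ?thesis by simp
qed

text \<open>Rule induction over this form of the spanned lattice carries facts from the generators
  to the whole lattice; \<open>column_lattice_eq_lat\<close> ties it to the generated subgroup of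
  the theorem.\<close>

inductive_set lat :: "(int ^ 'n::finite) set \<Rightarrow> (int ^ 'n) set" for A where
  zero: "0 \<in> lat A"
| gen: "a \<in> A \<Longrightarrow> a \<in> lat A"
| uminus: "x \<in> lat A \<Longrightarrow> - x \<in> lat A"
| add: "x \<in> lat A \<Longrightarrow> y \<in> lat A \<Longrightarrow> x + y \<in> lat A"

lemma lat_diff: "x \<in> lat A \<Longrightarrow> y \<in> lat A \<Longrightarrow> x - y \<in> lat A"
  by (metis add_uminus_conv_diff lat.add lat.uminus)

lemma smult_Suc: "int (Suc n) *s x = int n *s x + (x :: int ^ 'n)" "int 0 *s x = 0"
  by (simp_all add: Finite_Cartesian_Product.vec_eq_iff algebra_simps)

lemma lat_smult: "x \<in> lat A \<Longrightarrow> k *s x \<in> lat A" for k :: int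
proof (induction k)
  case (nonneg n)
  have "int n *s x \<in> lat A" by (induction n)
    (use nonneg in \<open>auto simp: smult_Suc simp del: of_nat_Suc intro: lat.intros\<close>)
  then show ?case .
next
  case (neg n)
  have "int m *s x \<in> lat A" for m by (induction m)
    (use neg in \<open>auto simp: smult_Suc simp del: of_nat_Suc intro: lat.intros\<close>)
  moreover have "(- int (Suc n)) *s x = - (int (Suc n) *s x)"
    by (simp add: Finite_Cartesian_Product.vec_eq_iff algebra_simps)
  ultimately show ?case by (metis lat.uminus)
qed

lemma mcong_lat: "mcong A b c \<Longrightarrow> ivec b - ivec c \<in> lat A"
proof (induction rule: mcong.induct)
  case (gen a u)
  have "ivec (u + pos_part a) - ivec (u + neg_part a) = a"
    using ivec_parts[of a] by (simp add: algebra_simps)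
  then show ?case using gen by (simp add: lat.gen)
next
  case (sym b c)
  then show ?case using lat.uminus[of "ivec b - ivec c" A] by simp
next
  case (trans b c e)
  then show ?case using lat.add[of "ivec b - ivec c" A "ivec c - ivec e"] by simp
qed (simp add: lat.zero)

text \<open>Differences of congruent pairs contain the generators and are closed under sum and
  negation, because congruences can be added and reversed.\<close>

lemma lat_cong_witness: "x \<in> lat A \<Longrightarrow> \<exists>b c. ivec b - ivec c = x \<and> mcong A b c"
proof (induction rule: lat.induct)
  case zero
  have "ivec 0 - ivec 0 = 0" "mcong A 0 0" by (auto intro: mcong.refl)
  then show ?case by blast
next
  case (gen a)
  then show ?case using ivec_parts[of a] mcong.gen[of a A 0] by auto
next
  case (uminus x)
  then show ?case by (metis mcong.sym minus_diff_eq)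
next
  case (add x y)
  then obtain b c b' c' where "ivec b - ivec c = x" "mcong A b c" "ivec b' - ivec c' = y" "mcong A b' c'"
    by blast
  then have "ivec (b + b') - ivec (c + c') = x + y" "mcong A (b + b') (c + c')"
    by (auto intro: mcong_add2)
  then show ?case by blast
qed

text \<open>A partial converse of \<open>mcong_lat\<close>. The common summand \<open>u\<close> is
  the price for congruence not being cancellative in general.\<close>

lemma lat_imp_mcong:
  assumes "ivec b - ivec c \<in> lat A"
  obtains u where "mcong A (b + u) (c + u)"
proof -
  obtain b' c' where x: "ivec b' - ivec c' = ivec b - ivec c" and *: "mcong A b' c'"
    using lat_cong_witness[OF assms] by blast
  \<comment> \<open>The witness is \<open>u = b'\<close>: both pairs have the same difference, so
    \<open>c + b'\<close> equals \<open>b + c'\<close>, which arises from \<open>b + b'\<close> by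
    replacing \<open>b'\<close> with the congruent \<open>c'\<close>.\<close>
  have "ivec (c + b') = ivec (b + c')" using x by (simp add: algebra_simps)
  then have eq: "c + b' = b + c'" by (rule ivec_inj)
  have "mcong A (b + b') (c + b')"
    unfolding eq using mcong_add[OF *, of b] by (simp add: add.commute)
  then show ?thesis by (rule that)
qed

section \<open>Representatives of minimal total degree\<close>

abbreviation tdeg :: "('n::finite \<Rightarrow>\<^sub>0 nat) \<Rightarrow> nat" where
  "tdeg \<equiv> weight (\<lambda>_. 1)"

text \<open>The choice depends on the predicate \<open>mcong A c\<close> only, so congruent
  exponents get the same representative. Minimality makes a class meet the degrees up to i exactly
  when its representative has degree at most i.\<close>

definition rep :: "(int ^ 'n::finite) set \<Rightarrow> ('n \<Rightarrow>\<^sub>0 nat) \<Rightarrow> ('n \<Rightarrow>\<^sub>0 nat)" where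
  "rep A c = (ARG_MIN tdeg r. mcong A c r)"

lemma rep_mcong: "mcong A c (rep A c)"
  unfolding rep_def by (rule arg_min_natI[of _ c]) (rule mcong.refl)

lemma rep_le: "mcong A c r \<Longrightarrow> tdeg (rep A c) \<le> tdeg r"
  unfolding rep_def by (rule arg_min_nat_le)

lemma rep_eq_iff: "rep A b = rep A c \<longleftrightarrow> mcong A b c"
proof
  assume "mcong A b c"
  then have "mcong A b = mcong A c"
    using mcong.trans[of A b c] mcong.trans[OF mcong.sym[of A b c]] by (intro ext iffI)
  then show "rep A b = rep A c" by (simp add: rep_def)
next
  assume "rep A b = rep A c"
  then have "mcong A b (rep A c)" using rep_mcong[of A b] by simp
  then show "mcong A b c" by (rule mcong.trans) (rule mcong.sym[OF rep_mcong])
qed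

lemma rep_rep [simp]: "rep A (rep A c) = rep A c"
  unfolding rep_eq_iff by (rule mcong.sym[OF rep_mcong])

lemma rep_add_rep: "rep A (rep A c + u) = rep A (c + u)"
  unfolding rep_eq_iff by (rule mcong_add) (rule mcong.sym[OF rep_mcong])

text \<open>When a window of \<open>p\<close> consecutive values moves by one, its sum
  \<open>g\<close> changes by \<open>f (w + p) - f w\<close>. So \<open>g\<close> does not increase
  from \<open>N\<close> on and is constant from the place of its minimum, which settles all residue
  classes modulo \<open>p\<close> at once.\<close>

lemma eventually_periodic_nat:
  fixes f :: "nat \<Rightarrow> nat"
  assumes "\<And>w. w \<ge> N \<Longrightarrow> f (w + p) \<le> f w"
  obtains M where "M \<ge> N" "\<And>w. w \<ge> M \<Longrightarrow> f (w + p) = f w"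
proof -
  define g where "g w = (\<Sum>x<p. f (w + x))" for w
  have step: "g (Suc w) + f w = g w + f (w + p)" for w
  proof -
    have "g w + f (w + p) = (\<Sum>x<Suc p. f (w + x))" by (simp add: g_def)
    also have "\<dots> = f w + g (Suc w)" unfolding g_def
      by (subst sum.lessThan_Suc_shift) simp
    finally show ?thesis by simp
  qed
  define M where "M = (ARG_MIN g w. w \<ge> N)"
  have M: "M \<ge> N" unfolding M_def by (rule arg_min_natI[of _ N]) simp
  have min: "g M \<le> g w" if "w \<ge> N" for w
    unfolding M_def by (rule arg_min_nat_le) (use that in simp)
  have const: "g w = g M" if "w \<ge> M" for w using that
  proof (induction w rule: dec_induct)
    case (step w)
    then show ?case using \<open>\<And>w. g (Suc w) + f w = g w + f (w + p)\<close>[of w] assms[of w] M min[of "Suc w"]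
      by simp
  qed simp
  have "f (w + p) = f w" if "w \<ge> M" for w
    using step[of w] const[of w] const[of "Suc w"] that by simp
  with M show ?thesis by (rule that)
qed

text \<open>The sets \<open>F\<close> considered in \<open>face\<close>, those containing the
  supports of both monomials of a generator or of neither, are the ones whose indicator vector is a
  zero of I. The assumption leaves only the empty set and the set of all indices.\<close>

locale no_face =
  fixes A :: "(int ^ 'n::finite) set" and d :: "'n \<Rightarrow> nat"
  assumes d_pos: "d i > 0"
    and Gcd_d: "Gcd (range d) = 1"
    and dot_gen: "a \<in> A \<Longrightarrow> dot d a = 0"
    and face: "F \<noteq> {} \<Longrightarrow> (\<And>a. a \<in> A \<Longrightarrow> {i. a $ i > 0} \<subseteq> F \<longleftrightarrow> {i. a $ i < 0} \<subseteq> F) \<Longrightarrow> F = UNIV"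
begin

section \<open>Reaching every variable in large weight\<close>

lemma dot_lat: "x \<in> lat A \<Longrightarrow> dot d x = 0"
  by (induction rule: lat.induct) (auto simp: dot_gen)

lemma mcong_weight: "mcong A b c \<Longrightarrow> weight d b = weight d c"
  using dot_lat[OF mcong_lat] by fastforce

lemma weight_rep [simp]: "weight d (rep A c) = weight d c"
  using mcong_weight[OF rep_mcong] by metis

text \<open>The indices \<open>i\<close> that are reached from \<open>j\<close> form a set
  \<open>F\<close> to which \<open>face\<close> applies. Multiplying the relations shows that some
  power of t_j is congruent to a multiple of any monomial supported in \<open>F\<close>. If that
  monomial is one side of a generator, it may be exchanged for the other side, whose variables are
  then reached too.\<close>

lemma reach: "\<exists>k c. mcong A (Poly_Mapping.single j k) (c + Poly_Mapping.single i 1)"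
proof -
  define F where "F = {i. \<exists>k c. mcong A (Poly_Mapping.single j k) (c + Poly_Mapping.single i 1)}"
  have j: "j \<in> F"
  proof -
    have "mcong A (Poly_Mapping.single j 1) (0 + Poly_Mapping.single j 1)" by (simp add: mcong.refl)
    then show ?thesis unfolding F_def by blast
  qed
  have mult: "\<exists>k c. mcong A (Poly_Mapping.single j k) (c + u)" if "\<forall>i. Poly_Mapping.lookup u i > 0 \<longrightarrow> i \<in> F" for u
    using that
  proof (induction u rule: poly_mapping_nat_induct)
    case zero
    have "mcong A (Poly_Mapping.single j 0) (0 + 0)" by (simp add: mcong.refl)
    then show ?case by blast
  next
    case (add u i)
    have "\<forall>i. Poly_Mapping.lookup u i > 0 \<longrightarrow> i \<in> F" "i \<in> F"
      using add.prems by (auto simp: lookup_add)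
    then obtain k c k' c' where "mcong A (Poly_Mapping.single j k) (c + u)"
      "mcong A (Poly_Mapping.single j k') (c' + Poly_Mapping.single i 1)"
      using add.IH by (auto simp: F_def)
    from mcong_add2[OF this] have "mcong A (Poly_Mapping.single j (k + k')) ((c + c') + (u + Poly_Mapping.single i 1))"
      by (simp add: single_add ac_simps)
    then show ?case by blast
  qed
  have div: "l \<in> F" if "mcong A (Poly_Mapping.single j k) (c + u)" "Poly_Mapping.lookup u l > 0" for k c u l
  proof -
    have "1 \<le> Poly_Mapping.lookup u l" using that(2) by simp
    then obtain v where "u = Poly_Mapping.single l 1 + v"
      by (rule poly_mapping_nat_single_decomp)
    then have "mcong A (Poly_Mapping.single j k) ((c + v) + Poly_Mapping.single l 1)"
      using that(1) by (simp add: ac_simps)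
    then show ?thesis unfolding F_def by blast
  qed
  have "F = UNIV"
  proof (rule face)
    show "F \<noteq> {}" using j by blast
    fix a assume a: "a \<in> A"
    have "{i. a $ i < 0} \<subseteq> F" if sub: "{i. a $ i > 0} \<subseteq> F"
    proof -
      obtain k c where "mcong A (Poly_Mapping.single j k) (c + pos_part a)"
        using mult[of "pos_part a"] sub by (auto simp: subset_iff)
      from mcong.trans[OF this mcong.gen[OF a]] div show ?thesis by (auto simp: subset_iff)
    qed
    moreover have "{i. a $ i > 0} \<subseteq> F" if sub: "{i. a $ i < 0} \<subseteq> F"
    proof -
      obtain k c where "mcong A (Poly_Mapping.single j k) (c + neg_part a)"
        using mult[of "neg_part a"] sub by (auto simp: subset_iff)
      from mcong.trans[OF this mcong.sym[OF mcong.gen[OF a]]] div show ?thesis by (auto simp: subset_iff)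
    qed
    ultimately show "{i. a $ i > 0} \<subseteq> F \<longleftrightarrow> {i. a $ i < 0} \<subseteq> F" by blast
  qed
  then show ?thesis unfolding F_def by blast
qed

text \<open>By pigeonhole an exponent of large weight has an entry at least \<open>K\<close>, and
  \<open>K\<close> bounds all the powers needed in \<open>reach\<close>.\<close>

lemma reach_of_large_weight:
  obtains N where "\<And>c i. weight d c \<ge> N \<Longrightarrow> \<exists>c'. mcong A c (c' + Poly_Mapping.single i 1)"
proof -
  define k where "k i j = (SOME k. \<exists>c. mcong A (Poly_Mapping.single j k) (c + Poly_Mapping.single i 1))" for i j
  have k: "\<exists>c. mcong A (Poly_Mapping.single j (k i j)) (c + Poly_Mapping.single i 1)" for i j
    unfolding k_def by (rule someI_ex) (rule reach)
  define K where "K = (\<Sum>i\<in>UNIV. \<Sum>j\<in>UNIV. k i j)"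
  have kK: "k i j \<le> K" for i j
  proof -
    have "k i j \<le> (\<Sum>j\<in>UNIV. k i j)" by (rule member_le_sum) auto
    also have "\<dots> \<le> K" unfolding K_def by (rule member_le_sum[of i UNIV]) auto
    finally show ?thesis .
  qed
  show ?thesis
  proof (rule that)
    fix c i assume c: "weight d c \<ge> (\<Sum>j\<in>UNIV. d j * K) + 1"
    have "\<exists>j. Poly_Mapping.lookup c j \<ge> K"
    proof (rule ccontr)
      assume "\<not> ?thesis"
      then have "weight d c \<le> (\<Sum>j\<in>UNIV. d j * K)"
        unfolding weight_def by (intro sum_mono mult_left_mono) (auto simp: not_le less_imp_le)
      with c show False by simp
    qed
    then obtain j where "k i j \<le> Poly_Mapping.lookup c j"
      using kK[of i] le_trans by blast
    then obtain u where u: "c = Poly_Mapping.single j (k i j) + u"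
      by (rule poly_mapping_nat_single_decomp)
    obtain c' where "mcong A (Poly_Mapping.single j (k i j)) (c' + Poly_Mapping.single i 1)" using k by blast
    from mcong_add[OF this, of u] show "\<exists>c'. mcong A c (c' + Poly_Mapping.single i 1)"
      unfolding u by (metis add.commute add.left_commute)
  qed
qed

section \<open>Multiplication by a variable on the classes of a given weight\<close>

definition Rw :: "nat \<Rightarrow> ('n \<Rightarrow>\<^sub>0 nat) set" where
  "Rw w = {r. rep A r = r \<and> weight d r = w}"

lemma finite_Rw [simp]: "finite (Rw w)"
  by (rule finite_subset[OF _ finite_weight_le[of d w]]) (auto simp: Rw_def d_pos)

lemma rep_in_Rw [simp]: "rep A c \<in> Rw w \<longleftrightarrow> weight d c = w"
  by (simp add: Rw_def)

text \<open>Multiplication by the j-th variable, read on representatives. The monomial classes being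
  a basis, \<open>card (Rw w)\<close> is the dimension of the component of S/I of weight w.\<close>

abbreviation shift :: "'n \<Rightarrow> ('n \<Rightarrow>\<^sub>0 nat) \<Rightarrow> ('n \<Rightarrow>\<^sub>0 nat)" where
  "shift j r \<equiv> rep A (r + Poly_Mapping.single j 1)"

lemma shift_surj:
  obtains N where "\<And>w j. w \<ge> N \<Longrightarrow> shift j ` Rw w = Rw (w + d j)"
proof -
  obtain N where N: "\<And>c i. weight d c \<ge> N \<Longrightarrow> \<exists>c'. mcong A c (c' + Poly_Mapping.single i 1)"
    by (rule reach_of_large_weight) blast
  have "shift j ` Rw w = Rw (w + d j)" if w: "w \<ge> N" for w j
  proof
    show "shift j ` Rw w \<subseteq> Rw (w + d j)" by (auto simp: weight_add Rw_def)
    show "Rw (w + d j) \<subseteq> shift j ` Rw w"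
    proof
      fix r assume r: "r \<in> Rw (w + d j)"
      then obtain c' where c': "mcong A r (c' + Poly_Mapping.single j 1)"
        using N[of r j] w by (auto simp: Rw_def)
      have "weight d c' + d j = w + d j"
        using mcong_weight[OF c'] r by (simp add: Rw_def weight_add)
      moreover have "r = shift j (rep A c')"
        using r c' by (simp add: rep_add_rep Rw_def rep_eq_iff[symmetric])
      ultimately show "r \<in> shift j ` Rw w" by (metis add_right_cancel image_eqI rep_in_Rw)
    qed
  qed
  then show ?thesis by (rule that)
qed

text \<open>Surjectivity makes \<open>card (Rw w)\<close> nonincreasing along steps of
  \<open>d j\<close>, so eventually constant along them, and a surjection between finite sets of
  equal size is injective. The sum of the thresholds \<open>M j\<close> serves all \<open>j\<close>
  at once.\<close>

lemma shift_bij: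
  obtains N where "\<And>w j. w \<ge> N \<Longrightarrow> bij_betw (shift j) (Rw w) (Rw (w + d j))"
proof -
  obtain N where N: "\<And>w j. w \<ge> N \<Longrightarrow> shift j ` Rw w = Rw (w + d j)"
    by (rule shift_surj) blast
  have "\<exists>M\<ge>N. \<forall>w\<ge>M. card (Rw (w + d j)) = card (Rw w)" for j
  proof -
    have "card (Rw (w + d j)) \<le> card (Rw w)" if "w \<ge> N" for w
      using N[OF that, of j] card_image_le[of "Rw w" "shift j"] by simp
    then show ?thesis using eventually_periodic_nat[of N "\<lambda>w. card (Rw w)" "d j"] by metis
  qed
  then obtain M where M: "\<And>j. M j \<ge> N" "\<And>j w. w \<ge> M j \<Longrightarrow> card (Rw (w + d j)) = card (Rw w)"
    by metis
  have "bij_betw (shift j) (Rw w) (Rw (w + d j))" if "w \<ge> (\<Sum>j\<in>UNIV. M j)" for w j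
  proof -
    have "M j \<le> (\<Sum>j\<in>UNIV. M j)" by (rule member_le_sum) auto
    then have w: "w \<ge> M j" "w \<ge> N" using that M(1)[of j] by auto
    have img: "shift j ` Rw w = Rw (w + d j)" using N w by blast
    then have "inj_on (shift j) (Rw w)"
      using M(2)[OF w(1)] by (intro eq_card_imp_inj_on) auto
    with img show ?thesis by (simp add: bij_betw_def)
  qed
  then show ?thesis by (rule that)
qed

text \<open>Congruence holds after adding some exponent (\<open>lat_imp_mcong\<close>). Its
  variables are removed one at a time by injectivity of the shifts, which applies because every
  intermediate weight is still at least \<open>N\<close>.\<close>

lemma lat_imp_mcong_of_large_weight:
  obtains N where "\<And>b c. weight d b \<ge> N \<Longrightarrow> ivec b - ivec c \<in> lat A \<Longrightarrow> mcong A b c"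
proof -
  obtain N where N: "\<And>w j. w \<ge> N \<Longrightarrow> bij_betw (shift j) (Rw w) (Rw (w + d j))"
    by (rule shift_bij) blast
  have cancel1: "mcong A b c" if "mcong A (b + Poly_Mapping.single j 1) (c + Poly_Mapping.single j 1)"
    and w: "weight d b \<ge> N" for b c j
  proof -
    have eq: "weight d c = weight d b" using mcong_weight[OF that(1)] by (simp add: weight_add)
    have "shift j (rep A b) = shift j (rep A c)"
      using that(1) by (simp add: rep_add_rep rep_eq_iff)
    then have "rep A b = rep A c"
      using bij_betw_imp_inj_on[OF N[OF w, of j]] eq by (simp add: inj_on_def)
    then show ?thesis by (simp add: rep_eq_iff)
  qed
  have cancel: "mcong A b c" if "mcong A (b + u) (c + u)" and "weight d b \<ge> N" for b c u
    using that
  proof (induction u arbitrary: b c rule: poly_mapping_nat_induct)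
    case (add u j)
    have "mcong A (b + u) (c + u)"
      by (rule cancel1[of _ j]) (use add.prems in \<open>simp_all add: add.assoc weight_add\<close>)
    then show ?case using add by blast
  qed simp
  show ?thesis
    by (rule that[of N]) (metis cancel lat_imp_mcong)
qed

section \<open>Cosets of the lattice and the number of classes of large weight\<close>

definition coset :: "int ^ 'n \<Rightarrow> (int ^ 'n) set" where
  "coset x = {y. y - x \<in> lat A}"

lemma coset_eq_iff: "coset x = coset y \<longleftrightarrow> x - y \<in> lat A"
proof
  assume "coset x = coset y"
  moreover have "x \<in> coset x" by (simp add: coset_def lat.zero)
  ultimately show "x - y \<in> lat A" by (simp add: coset_def)
next
  assume *: "x - y \<in> lat A"
  have "z - x \<in> lat A \<longleftrightarrow> z - y \<in> lat A" for z
    using lat.add[OF _ *, of "z - x"] lat_diff[OF _ *, of "z - y"] by auto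
  then show "coset x = coset y" by (simp add: coset_def)
qed

text \<open>This is the torsion subgroup of the quotient by the lattice
  (\<open>torsion_subgroup_eq_Tor\<close>), written in a form that can be counted before the cosets
  are known to have finite order.\<close>

definition Tor :: "(int ^ 'n) set set" where
  "Tor = coset ` {x. dot d x = 0}"

lemma bezout_d:
  obtains v where "dot d v = 1"
proof -
  have "\<exists>v. dot d v = int (Gcd (d ` S))" if "finite S" for S using that
  proof (induction S rule: finite_induct)
    case empty
    show ?case by (rule exI[of _ 0]) simp
  next
    case (insert i S)
    then obtain v where v: "dot d v = int (Gcd (d ` S))" by blast
    obtain a b where ab: "a * int (d i) + b * int (Gcd (d ` S)) = gcd (int (d i)) (int (Gcd (d ` S)))"
      using bezout_int by blast
    have "dot d (a *s axis i 1 + b *s v) = int (Gcd (d ` insert i S))"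
      using ab v by (simp add: dot_axis)
    then show ?case by blast
  qed
  from this[of UNIV] Gcd_d that show ?thesis by auto
qed

text \<open>Division by one \<open>d j\<close> brings the weight down to a remainder, which is
  supplied by a multiple of a vector \<open>v\<close> of weight 1; a large constant vector keeps all
  entries at least \<open>n\<close>.\<close>

lemma exists_large_of_weight:
  obtains N where "\<And>w. w \<ge> N \<Longrightarrow> \<exists>c. weight d c = w \<and> (\<forall>i. Poly_Mapping.lookup c i \<ge> n)"
proof -
  obtain v where v: "dot d v = 1" by (rule bezout_d)
  fix j
  define V where "V = (\<Sum>i\<in>UNIV. \<bar>v $ i\<bar>)"
  have V: "\<bar>v $ i\<bar> \<le> V" for i
    unfolding V_def by (rule member_le_sum) auto
  \<comment> \<open>The summand \<open>int (d j) * V\<close> absorbs the negative entries of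
    \<open>int r *s v\<close>, as \<open>r < d j\<close> and all entries of \<open>v\<close> are at
    least \<open>- V\<close>.\<close>
  define n' where "n' = int n + int (d j) * V"
  have "V \<ge> 0" unfolding V_def by (rule sum_nonneg) simp
  then have n': "n' \<ge> 0" by (simp add: n'_def)
  define N where "N = nat n' * (\<Sum>i\<in>UNIV. d i)"
  show ?thesis
  proof (rule that[of N])
    fix w assume w: "w \<ge> N"
    define q r where "q = (w - N) div d j" and "r = (w - N) mod d j"
    have r: "r < d j" using d_pos by (simp add: r_def)
    have wqr: "w = N + q * d j + r" using w by (simp add: q_def r_def)
    define x where "x = n' *s (\<chi> i. 1) + int q *s axis j 1 + int r *s v"
    have xn: "x $ i \<ge> int n" for i
    proof -
      have "int r * \<bar>v $ i\<bar> \<le> int (d j) * V"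
        using r V[of i] \<open>V \<ge> 0\<close> by (intro mult_mono) auto
      moreover have "\<bar>int r * v $ i\<bar> = int r * \<bar>v $ i\<bar>" by (simp add: abs_mult)
      moreover have "int q * axis j 1 $ i \<ge> 0" by (simp add: axis_def)
      ultimately show ?thesis unfolding x_def n'_def by simp
    qed
    define c where "c = Abs_poly_mapping (\<lambda>i. nat (x $ i))"
    have c: "Poly_Mapping.lookup c i = nat (x $ i)" for i unfolding c_def by simp
    have "ivec c = x"
      using order_trans[OF _ xn, of 0] by (simp add: Finite_Cartesian_Product.vec_eq_iff c)
    then have "int (weight d c) = dot d x" by (metis dot_ivec)
    also have "dot d x = n' * (\<Sum>i\<in>UNIV. int (d i)) + int q * int (d j) + int r"
      unfolding x_def using v by (simp add: dot_axis dot_def[of d "\<chi> i. 1"])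
    also have "\<dots> = int w" unfolding wqr N_def using n' by simp
    finally have "weight d c = w" by simp
    moreover have "\<forall>i. Poly_Mapping.lookup c i \<ge> n" using nat_mono[OF xn] c by simp
    ultimately show "\<exists>c. weight d c = w \<and> (\<forall>i. Poly_Mapping.lookup c i \<ge> n)" by blast
  qed
qed

text \<open>Representatives of finitely many cosets have entries bounded below by some
  \<open>- n\<close>. Added to one exponent of weight w with all entries at least \<open>n\<close>,
  they become exponents of weight w that differ modulo the lattice, hence are incongruent. Finite
  subsets are used because this bound is what proves \<open>Tor\<close> finite.\<close>

lemma card_le_card_Rw:
  assumes "finite F" "F \<subseteq> Tor"
  obtains N where "\<And>w. w \<ge> N \<Longrightarrow> card F \<le> card (Rw w)"
proof -
  obtain Y where Y: "finite Y" "Y \<subseteq> {x. dot d x = 0}" "F = coset ` Y" "inj_on coset Y"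
    using assms unfolding Tor_def by (metis (no_types, lifting) finite_image_iff subset_image_inj)
  define n where "n = nat (\<Sum>x\<in>Y. \<Sum>i\<in>UNIV. \<bar>x $ i\<bar>)"
  have n: "- x $ i \<le> int n" if "x \<in> Y" for x i
  proof -
    have "\<bar>x $ i\<bar> \<le> (\<Sum>i\<in>UNIV. \<bar>x $ i\<bar>)" by (rule member_le_sum) auto
    moreover have "(\<Sum>i\<in>UNIV. \<bar>x $ i\<bar>) \<le> (\<Sum>x\<in>Y. \<Sum>i\<in>UNIV. \<bar>x $ i\<bar>)"
      by (rule member_le_sum[OF that]) (auto simp: Y(1) intro: sum_nonneg)
    ultimately show ?thesis unfolding n_def by linarith
  qed
  obtain N where N: "\<And>w. w \<ge> N \<Longrightarrow> \<exists>c. weight d c = w \<and> (\<forall>i. Poly_Mapping.lookup c i \<ge> n)"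
    by (rule exists_large_of_weight[of n]) blast
  have "card F \<le> card (Rw w)" if w: "w \<ge> N" for w
  proof -
    obtain c where c: "weight d c = w" "\<And>i. Poly_Mapping.lookup c i \<ge> n" using N[OF w] by blast
    define g where "g x = Abs_poly_mapping (\<lambda>i. nat (ivec c $ i + x $ i))" for x :: "int ^ 'n"
    have g: "ivec (g x) = ivec c + x" if "x \<in> Y" for x
    proof -
      have "ivec c $ i + x $ i \<ge> 0" for i using n[OF that, of i] c(2)[of i] by simp
      then show ?thesis by (simp add: Finite_Cartesian_Product.vec_eq_iff g_def)
    qed
    have gw: "weight d (g x) = w" if "x \<in> Y" for x
    proof -
      have "int (weight d (g x)) = int w" using g[OF that] Y(2) that c(1) dot_ivec[of d "g x"] by auto
      then show ?thesis by simp
    qed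
    have "inj_on (\<lambda>x. rep A (g x)) Y"
    proof (rule inj_onI)
      fix x y assume xy: "x \<in> Y" "y \<in> Y" "rep A (g x) = rep A (g y)"
      then have "ivec (g x) - ivec (g y) \<in> lat A" by (simp add: rep_eq_iff mcong_lat)
      then have "coset x = coset y" using g xy by (simp add: coset_eq_iff)
      then show "x = y" using Y(4) xy by (simp add: inj_on_def)
    qed
    then have "card Y = card ((\<lambda>x. rep A (g x)) ` Y)" by (simp add: card_image)
    also have "\<dots> \<le> card (Rw w)" by (rule card_mono) (auto simp: gw)
    finally show ?thesis using Y by (simp add: card_image)
  qed
  then show ?thesis by (rule that)
qed

text \<open>Along the weights \<open>N + q * d j\<close> the number of classes is constant, and for
  large \<open>q\<close> it bounds the size of any given finite set of cosets.\<close>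

lemma finite_Tor: "finite Tor"
proof -
  obtain N where N: "\<And>w j. w \<ge> N \<Longrightarrow> bij_betw (shift j) (Rw w) (Rw (w + d j))"
    by (rule shift_bij) blast
  fix j
  have const: "card (Rw (N + q * d j)) = card (Rw N)" for q
  proof (induction q)
    case (Suc q)
    then show ?case using bij_betw_same_card[OF N[of "N + q * d j" j]] by (simp add: algebra_simps)
  qed simp
  have "card F \<le> card (Rw N)" if F: "finite F" "F \<subseteq> Tor" for F
  proof -
    obtain M where M: "\<And>w. w \<ge> M \<Longrightarrow> card F \<le> card (Rw w)"
      using card_le_card_Rw[OF F] by blast
    have "M \<le> M * d j" using d_pos[of j] by (cases "d j") auto
    then have "M \<le> N + M * d j" by (rule trans_le_add2)
    from M[OF this] const show ?thesis by simp
  qed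
  then show ?thesis by (rule finite_if_finite_subsets_card_bdd[of _ "card (Rw N)", THEN conjunct1]) blast
qed

text \<open>In large weight lattice equivalence implies congruence, so subtracting one fixed
  representative embeds \<open>Rw w\<close> into \<open>Tor\<close>. The reverse inequality is
  \<open>card_le_card_Rw\<close> for the whole of \<open>Tor\<close>.\<close>

lemma card_Rw_eq_card_Tor:
  obtains N where "\<And>w. w \<ge> N \<Longrightarrow> card (Rw w) = card Tor"
proof -
  obtain N where N: "\<And>w. w \<ge> N \<Longrightarrow> card Tor \<le> card (Rw w)"
    using card_le_card_Rw[OF finite_Tor subset_refl] by blast
  obtain M where M: "\<And>b c. weight d b \<ge> M \<Longrightarrow> ivec b - ivec c \<in> lat A \<Longrightarrow> mcong A b c"
    by (rule lat_imp_mcong_of_large_weight) blast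
  have "card (Rw w) \<le> card Tor" if "w \<ge> M" for w
  proof (cases "Rw w = {}")
    case False
    then obtain c where c: "c \<in> Rw w" by blast
    have "inj_on (\<lambda>r. coset (ivec r - ivec c)) (Rw w)"
    proof (rule inj_onI)
      fix r r' assume *: "r \<in> Rw w" "r' \<in> Rw w" "coset (ivec r - ivec c) = coset (ivec r' - ivec c)"
      then have "mcong A r r'" using that by (intro M) (auto simp: coset_eq_iff Rw_def)
      then show "r = r'" using * by (metis (mono_tags) Rw_def mem_Collect_eq rep_eq_iff)
    qed
    moreover have "(\<lambda>r. coset (ivec r - ivec c)) ` Rw w \<subseteq> Tor"
      using c by (auto simp: Tor_def Rw_def)
    ultimately show ?thesis using card_inj_on_le finite_Tor by blast
  qed simp
  then have "card (Rw w) = card Tor" if "w \<ge> max N M" for w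
    using N that by (simp add: le_antisym)
  then show ?thesis by (rule that)
qed

section \<open>Total degree against weight, and the linear growth of the count\<close>

lemma tdeg_le_weight: "tdeg r \<le> weight d r"
  unfolding weight_def using d_pos by (intro sum_mono mult_right_mono) (auto simp: Suc_leI)

lemma weight_le_tdeg: "weight d r \<le> Max (range d) * tdeg r"
  unfolding weight_def sum_distrib_left by (intro sum_mono) simp

text \<open>From weight \<open>N + d j\<close> on, a class is t_j times a class whose weight is less
  by \<open>d j\<close>, at the cost of one degree. Peeling off these factors leaves bounded weight,
  hence bounded degree. For \<open>d j\<close> maximal this complements
  \<open>weight_le_tdeg\<close>.\<close>

lemma tdeg_Rw_bound:
  obtains C where "\<And>r w. r \<in> Rw w \<Longrightarrow> d j * tdeg r \<le> w + C"
proof -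
  obtain N where N: "\<And>w j. w \<ge> N \<Longrightarrow> shift j ` Rw w = Rw (w + d j)"
    by (rule shift_surj) blast
  have "d j * tdeg r \<le> w + d j * (N + d j)" if "r \<in> Rw w" for r w
    using that
  proof (induction w arbitrary: r rule: less_induct)
    case (less w)
    show ?case
    proof (cases "w < N + d j")
      case True
      have "tdeg r \<le> w" using tdeg_le_weight[of r] less.prems by (simp add: Rw_def)
      then have "d j * tdeg r \<le> d j * (N + d j)" using True by (intro mult_left_mono) auto
      then show ?thesis by (rule trans_le_add2)
    next
      case False
      then have "r \<in> shift j ` Rw (w - d j)" using N[of "w - d j" j] less.prems by simp
      then obtain r' where r': "r' \<in> Rw (w - d j)" "r = shift j r'" by blast
      have "tdeg r \<le> tdeg (r' + Poly_Mapping.single j 1)"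
        unfolding r'(2) by (rule rep_le) (rule mcong.refl)
      then have "d j * tdeg r \<le> d j * (tdeg r' + 1)"
        by (intro mult_left_mono) (auto simp: weight_add)
      also have "\<dots> = d j * tdeg r' + d j" by simp
      also have "\<dots> \<le> (w - d j) + d j * (N + d j) + d j"
        using less.IH[OF _ r'(1)] False d_pos[of j] by simp
      also have "\<dots> = w + d j * (N + d j)" using False by simp
      finally show ?thesis .
    qed
  qed
  then show ?thesis by (rule that)
qed

text \<open>With D the maximum of the \<open>d i\<close>, representatives of degree at most i have
  weight at most D i, and all those of weight at most D i - C occur. All but boundedly many of these
  weights carry exactly \<open>card Tor\<close> classes.\<close>

lemma card_rep_tdeg_le:
  obtains C :: real where
    "\<And>i. \<bar>real (card {r. rep A r = r \<and> tdeg r \<le> i}) - real (Max (range d) * card Tor) * real i\<bar> \<le> C"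
proof -
  define D where "D = Max (range d)"
  define \<tau> where "\<tau> = card Tor"
  have "D \<in> range d" unfolding D_def by (rule Max_in) auto
  then obtain j where j: "D = d j" by blast
  obtain C where C: "\<And>r w. r \<in> Rw w \<Longrightarrow> d j * tdeg r \<le> w + C" by (rule tdeg_Rw_bound) blast
  obtain N where N: "\<And>w. w \<ge> N \<Longrightarrow> card (Rw w) = \<tau>"
    unfolding \<tau>_def by (rule card_Rw_eq_card_Tor) blast
  define B where "B = (\<Sum>w<N. card (Rw w))"
  let ?H = "\<lambda>i. {r. rep A r = r \<and> tdeg r \<le> i}"
  have fin: "finite (?H i)" for i
    by (rule finite_subset[OF _ finite_weight_le[of "\<lambda>_. 1" i]]) auto
  have upper: "card (?H i) \<le> B + \<tau> * (D * i + 1)" for i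
  proof -
    have "?H i \<subseteq> (\<Union>w\<in>{..D * i}. Rw w)"
    proof
      fix r assume "r \<in> ?H i"
      then have r: "rep A r = r" "tdeg r \<le> i" by auto
      have "weight d r \<le> D * tdeg r" using weight_le_tdeg[of r] by (simp add: D_def)
      also have "\<dots> \<le> D * i" using r by simp
      finally show "r \<in> (\<Union>w\<in>{..D * i}. Rw w)" using r by (auto simp: Rw_def)
    qed
    then have "card (?H i) \<le> card (\<Union>w\<in>{..D * i}. Rw w)" by (intro card_mono) auto
    also have "\<dots> \<le> (\<Sum>w\<in>{..D * i}. card (Rw w))" by (rule card_UN_le) simp
    also have "\<dots> \<le> (\<Sum>w\<in>{..D * i}. (if w < N then card (Rw w) else 0) + \<tau>)"
      by (intro sum_mono) (auto simp: N)
    also have "\<dots> = (\<Sum>w\<in>{..D * i} \<inter> {..<N}. card (Rw w)) + \<tau> * (D * i + 1)"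
      by (simp add: sum.distrib sum.If_cases lessThan_def)
    also have "(\<Sum>w\<in>{..D * i} \<inter> {..<N}. card (Rw w)) \<le> B"
      unfolding B_def by (rule sum_mono2) auto
    finally show ?thesis by simp
  qed
  \<comment> \<open>Subtraction is truncated: the interval from \<open>N\<close> below
    \<open>D * i + 1 - C\<close> holds the weights \<open>w\<close> with \<open>N \<le> w\<close>
    and \<open>w + C \<le> D * i\<close>, and is empty for small \<open>i\<close>.\<close>
  have lower: "\<tau> * (D * i + 1 - C - N) \<le> card (?H i)" for i
  proof -
    have "(\<Union>w\<in>{N..<D * i + 1 - C}. Rw w) \<subseteq> ?H i"
    proof
      fix r assume "r \<in> (\<Union>w\<in>{N..<D * i + 1 - C}. Rw w)"
      then obtain w where w: "w \<in> {N..<D * i + 1 - C}" "r \<in> Rw w" by blast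
      then have "d j * tdeg r \<le> d j * i" using C[OF w(2)] w(1) unfolding j atLeastLessThan_iff by linarith
      then have "tdeg r \<le> i" using d_pos[of j] by (simp only: mult_le_cancel1)
      then show "r \<in> ?H i" using w by (auto simp: Rw_def)
    qed
    from card_mono[OF fin this] have "card (\<Union>w\<in>{N..<D * i + 1 - C}. Rw w) \<le> card (?H i)" .
    moreover have "card (\<Union>w\<in>{N..<D * i + 1 - C}. Rw w) = (\<Sum>w\<in>{N..<D * i + 1 - C}. card (Rw w))"
      by (rule card_UN_disjoint) (simp_all, auto simp: Rw_def)
    moreover have "\<dots> = (\<Sum>w\<in>{N..<D * i + 1 - C}. \<tau>)" by (rule sum.cong) (auto simp: N)
    ultimately show ?thesis by (simp add: mult.commute)
  qed
  have "\<bar>real (card (?H i)) - real (D * \<tau>) * real i\<bar> \<le> real B + real \<tau> * (real C + real N + 1)" for i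
  proof -
    have "real (card (?H i)) \<le> real (B + \<tau> * (D * i + 1))" using upper[of i] by (rule of_nat_mono)
    also have "\<dots> = real (D * \<tau>) * real i + (real B + real \<tau>)" by (simp add: algebra_simps)
    finally have 1: "real (card (?H i)) \<le> real (D * \<tau>) * real i + (real B + real \<tau>)" .
    have "real (D * i) - (real C + real N) \<le> real (D * i + 1 - C - N)" by linarith
    then have "real \<tau> * (real (D * i) - (real C + real N)) \<le> real \<tau> * real (D * i + 1 - C - N)"
      by (rule mult_left_mono) simp
    also have "\<dots> \<le> real (card (?H i))" using of_nat_mono[OF lower[of i]] by simp
    finally have 2: "real (D * \<tau>) * real i - real \<tau> * (real C + real N) \<le> real (card (?H i))"
      by (simp add: algebra_simps)
    have "0 \<le> real \<tau> * (real C + real N)" by simp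
    with 1 2 show ?thesis unfolding abs_le_iff by (simp only: distrib_left) linarith
  qed
  then show ?thesis using that unfolding D_def \<tau>_def by blast
qed

lemma card_rep_tdeg_le_limit:
  "(\<lambda>i. real (card {r. rep A r = r \<and> tdeg r \<le> i}) / real i) \<longlonglongrightarrow> real (Max (range d)) * real (card Tor)"
proof -
  let ?H = "\<lambda>i. real (card {r. rep A r = r \<and> tdeg r \<le> i})"
  let ?c = "real (Max (range d)) * real (card Tor)"
  obtain C :: real where C: "\<And>i. \<bar>?H i - ?c * real i\<bar> \<le> C"
    using card_rep_tdeg_le by auto
  have "(\<lambda>i. ?H i / real i - ?c) \<longlonglongrightarrow> 0"
  proof (rule tendsto_0_le)
    show "(\<lambda>i. C / real i) \<longlonglongrightarrow> 0" by (rule lim_const_over_n)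
    show "\<forall>\<^sub>F i in sequentially. norm (?H i / real i - ?c) \<le> norm (C / real i) * 1"
    proof (rule eventually_sequentiallyI[of 1])
      fix i :: nat assume "1 \<le> i"
      then have "?H i / real i - ?c = (?H i - ?c * real i) / real i" by (simp add: field_simps)
      then have "norm (?H i / real i - ?c) = \<bar>?H i - ?c * real i\<bar> / real i" by simp
      also have "\<dots> \<le> C / real i" by (rule divide_right_mono[OF C]) simp
      also have "\<dots> \<le> norm (C / real i) * 1" by (simp only: real_norm_def abs_ge_self mult_1_right)
      finally show "norm (?H i / real i - ?c) \<le> norm (C / real i) * 1" .
    qed
  qed
  then show ?thesis by (rule LIM_zero_cancel)
qed

end

subsection \<open>Linear maps given on monomials\<close>

text \<open>Common form of the normal form, of evaluation at a point and of the map to K[T] given by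
  weights. The coefficient is an argument of \<open>g\<close>, so additivity in it replaces a module
  structure on the target.\<close>

definition plift :: "('a \<Rightarrow> 'k \<Rightarrow> 'b) \<Rightarrow> ('a \<Rightarrow>\<^sub>0 'k::zero) \<Rightarrow> 'b::comm_monoid_add" where
  "plift g p = (\<Sum>c\<in>Poly_Mapping.keys p. g c (Poly_Mapping.lookup p c))"

lemma plift_zero [simp]: "plift g 0 = 0"
  by (simp add: plift_def)

lemma plift_single: "g c 0 = 0 \<Longrightarrow> plift g (Poly_Mapping.single c x) = g c x"
  by (simp add: plift_def)

lemma plift_add:
  fixes p q :: "'a \<Rightarrow>\<^sub>0 'k::comm_monoid_add"
  assumes "\<And>c. g c 0 = 0" "\<And>c x y. g c (x + y) = g c x + g c y"
  shows "plift g (p + q) = plift g p + plift g q"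
  unfolding plift_def by (rule setsum_keys_plus_distrib) (use assms in auto)

lemma plift_sum:
  fixes f :: "'i \<Rightarrow> 'a \<Rightarrow>\<^sub>0 'k::comm_monoid_add"
  assumes "\<And>c. g c 0 = 0" "\<And>c x y. g c (x + y) = g c x + g c y"
  shows "plift g (sum f S) = (\<Sum>i\<in>S. plift g (f i))"
  by (induction S rule: infinite_finite_induct) (auto simp: plift_add assms)

lemma sum_single_lookup: "(\<Sum>c\<in>Poly_Mapping.keys p. Poly_Mapping.single c (Poly_Mapping.lookup p c)) = p"
proof (rule poly_mapping_eqI)
  fix k
  have "Poly_Mapping.lookup (\<Sum>c\<in>Poly_Mapping.keys p. Poly_Mapping.single c (Poly_Mapping.lookup p c)) k
     = (\<Sum>c\<in>Poly_Mapping.keys p. if c = k then Poly_Mapping.lookup p k else 0)"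
    unfolding lookup_sum by (rule sum.cong) (auto simp: lookup_single when_def)
  then show "Poly_Mapping.lookup (\<Sum>c\<in>Poly_Mapping.keys p. Poly_Mapping.single c (Poly_Mapping.lookup p c)) k
     = Poly_Mapping.lookup p k"
    by (simp add: in_keys_iff)
qed

lemma plift_mult:
  fixes p q :: "'a::comm_monoid_add \<Rightarrow>\<^sub>0 'k::comm_semiring_1" and g :: "'a \<Rightarrow> 'k \<Rightarrow> 'b::comm_semiring_1"
  assumes g: "\<And>c. g c 0 = 0" "\<And>c x y. g c (x + y) = g c x + g c y"
    and mult: "\<And>b c x y. g (b + c) (x * y) = g b x * g c y"
  shows "plift g (p * q) = plift g p * plift g q"
proof -
  have "p * q = (\<Sum>b\<in>Poly_Mapping.keys p. \<Sum>c\<in>Poly_Mapping.keys q.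
      Poly_Mapping.single (b + c) (Poly_Mapping.lookup p b * Poly_Mapping.lookup q c))"
    by (subst (1 2) sum_single_lookup[symmetric]) (simp add: sum_product mult_single)
  then have "plift g (p * q) = (\<Sum>b\<in>Poly_Mapping.keys p. \<Sum>c\<in>Poly_Mapping.keys q.
      g b (Poly_Mapping.lookup p b) * g c (Poly_Mapping.lookup q c))"
    by (simp add: plift_sum g plift_single mult)
  then show ?thesis by (simp add: plift_def sum_product)
qed

subsection \<open>Ideals in a ring given by a type\<close>

lemma ideal_class_ringI:
  fixes J :: "'r::comm_ring_1 set"
  assumes "0 \<in> J" "\<And>x y. x \<in> J \<Longrightarrow> y \<in> J \<Longrightarrow> x + y \<in> J" "\<And>r x. x \<in> J \<Longrightarrow> r * x \<in> J"
  shows "Ideal.ideal J class_ring"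
proof (rule idealI)
  show "ring (class_ring :: 'r ring)" by (rule class_ring.ring_axioms)
  have "- x \<in> J" if "x \<in> J" for x using assms(3)[OF that, of "- 1"] by simp
  moreover have "inv\<^bsub>add_monoid class_ring\<^esub> x = - x" for x :: 'r
    using class_ring.minus_equality[of "- x" x] unfolding a_inv_def[symmetric] by (simp add: class_ring_simps)
  ultimately show "subgroup J (add_monoid class_ring)"
    by (intro subgroup.intro) (auto intro: assms)
qed (use assms(3) in \<open>auto simp: mult.commute\<close>)

context
  fixes J :: "'r::comm_ring_1 set"
  assumes J: "Ideal.ideal J class_ring"
begin

interpretation J: Ideal.ideal J class_ring by (rule J)

lemma ideal_zero: "0 \<in> J"
  using J.zero_closed by (simp add: class_ring_simps)

lemma ideal_add: "x \<in> J \<Longrightarrow> y \<in> J \<Longrightarrow> x + y \<in> J"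
  using J.a_closed[of x y] by (simp add: class_ring_simps)

lemma ideal_mult: "x \<in> J \<Longrightarrow> r * x \<in> J"
  using J.I_l_closed[of x r] by (simp add: class_ring_simps)

lemma ideal_minus: "x \<in> J \<Longrightarrow> y \<in> J \<Longrightarrow> x - y \<in> J"
  using ideal_add[of x "- 1 * y"] ideal_mult[of y "- 1"] by simp

lemma ideal_sum: "(\<And>i. i \<in> S \<Longrightarrow> f i \<in> J) \<Longrightarrow> sum f S \<in> J"
  by (induction S rule: infinite_finite_induct) (auto intro: ideal_zero ideal_add)

end

lemma ideal_Idl: "Ideal.ideal (Idl\<^bsub>class_ring\<^esub> G) (class_ring :: 'r::comm_ring_1 ring)"
  by (rule ring.genideal_ideal[OF class_ring.ring_axioms]) simp

lemma Idl_superset: "G \<subseteq> Idl\<^bsub>class_ring\<^esub> (G :: 'r::comm_ring_1 set)"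
  by (rule ring.genideal_self[OF class_ring.ring_axioms]) simp

lemma Idl_minimal: "Ideal.ideal J (class_ring :: 'r::comm_ring_1 ring) \<Longrightarrow> G \<subseteq> J \<Longrightarrow> Idl\<^bsub>class_ring\<^esub> G \<subseteq> J"
  by (rule ring.genideal_minimal[OF class_ring.ring_axioms])

lemma ideal_kernel:
  fixes h :: "'r::comm_ring_1 \<Rightarrow> 'q::comm_ring_1"
  assumes "\<And>x y. h (x + y) = h x + h y" "\<And>x y. h (x * y) = h x * h y"
  shows "Ideal.ideal {x. h x = 0} class_ring"
proof (rule ideal_class_ringI)
  show "0 \<in> {x. h x = 0}" using assms(1)[of 0 0] by simp
qed (auto simp: assms)

lemma prime_class_ringD:
  fixes P :: "'r::comm_ring_1 set"
  assumes "primeideal P class_ring" "x * y \<in> P"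
  shows "x \<in> P \<or> y \<in> P"
  using primeideal.I_prime[OF assms(1), of x y] assms(2) by simp

lemma prime_class_ring_one:
  fixes P :: "'r::comm_ring_1 set"
  assumes "primeideal P class_ring"
  shows "1 \<notin> P"
proof
  interpret primeideal P class_ring by (rule assms)
  assume "1 \<in> P"
  then have "P = UNIV" using ideal_mult[OF is_ideal, of 1] by auto
  then show False using I_notcarr by simp
qed

text \<open>As \<open>h\<close> vanishes on \<open>I\<close>, it factors through the quotient, and
  the kernel of a homomorphism into a domain is prime. The kernel is described by lifts
  \<open>x\<close>, so that the induced map does not appear in the statement.\<close>

lemma primeideal_quot_kernel:
  fixes h :: "'r::comm_ring_1 \<Rightarrow> 'q::idom"
  assumes I: "Ideal.ideal I class_ring" and "I \<subseteq> {x. h x = 0}"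
    and h: "\<And>x y. h (x + y) = h x + h y" "\<And>x y. h (x * y) = h x * h y" "h 1 = 1"
  shows "primeideal {C \<in> carrier (class_ring Quot I). \<exists>x. C = I +>\<^bsub>class_ring\<^esub> x \<and> h x = 0} (class_ring Quot I)"
proof -
  interpret I: Ideal.ideal I class_ring by (rule I)
  have carr: "\<exists>x. C = I +>\<^bsub>class_ring\<^esub> x" if "C \<in> carrier (class_ring Quot I)" for C
    using that by (auto simp: FactRing_def A_RCOSETS_def')
  have coset_h: "h x = h y" if x: "x \<in> I +>\<^bsub>class_ring\<^esub> y" for x y
  proof -
    obtain i where "i \<in> I" "x = i + y" using x by (auto simp: a_r_coset_def')
    then show ?thesis using assms(2) h(1) by auto
  qed
  \<comment> \<open>The induced map evaluates \<open>h\<close> at an arbitrary member of the coset;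
    \<open>coset_h\<close> makes the choice immaterial.\<close>
  define H where "H C = h (SOME x. x \<in> C)" for C
  have self: "x \<in> I +>\<^bsub>class_ring\<^esub> x" for x using I.a_rcos_self[of x] by simp
  have H: "H (I +>\<^bsub>class_ring\<^esub> x) = h x" for x
    unfolding H_def by (rule coset_h) (rule someI, rule self)
  have "H \<in> Ring.ring_hom (class_ring Quot I) class_ring"
  proof (rule ring_hom_memI)
    fix C D assume "C \<in> carrier (class_ring Quot I)" "D \<in> carrier (class_ring Quot I)"
    then obtain x y where xy: "C = I +>\<^bsub>class_ring\<^esub> x" "D = I +>\<^bsub>class_ring\<^esub> y"
      using carr by blast
    show "H (C \<otimes>\<^bsub>class_ring Quot I\<^esub> D) = H C \<otimes>\<^bsub>class_ring\<^esub> H D"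
      using I.rcoset_mult_add[of x y] by (simp add: xy FactRing_def H h)
    show "H (C \<oplus>\<^bsub>class_ring Quot I\<^esub> D) = H C \<oplus>\<^bsub>class_ring\<^esub> H D"
      using I.a_rcos_sum[of x y] by (simp add: xy FactRing_def H h)
  next
    show "H \<one>\<^bsub>class_ring Quot I\<^esub> = \<one>\<^bsub>class_ring\<^esub>"
      by (simp add: FactRing_def H h)
  qed simp
  then have hom: "ring_hom_ring (class_ring Quot I) class_ring H"
    by (intro ring_hom_ringI2 I.quotient_is_ring class_ring.ring_axioms)
  have dom: "domain (class_ring :: 'q ring)"
    by unfold_locales auto
  have cr: "cring (class_ring Quot I)"
    by (rule I.quotient_is_cring) (rule class_cring.cring_axioms)
  have "primeideal {0} (class_ring :: 'q ring)"
    using domain.zeroprimeideal[OF dom] by simp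
  from ring_hom_ring.primeideal_vimage[OF hom cr this]
  have "primeideal {C \<in> carrier (class_ring Quot I). H C \<in> {0}} (class_ring Quot I)" .
  moreover have "{C \<in> carrier (class_ring Quot I). H C \<in> {0}}
      = {C \<in> carrier (class_ring Quot I). \<exists>x. C = I +>\<^bsub>class_ring\<^esub> x \<and> h x = 0}"
    using carr H by fastforce
  ultimately show ?thesis by simp
qed

lemma quot_coset_eq_iff:
  fixes I :: "'r::comm_ring_1 set"
  assumes I: "Ideal.ideal I class_ring"
  shows "I +>\<^bsub>class_ring\<^esub> x = I +>\<^bsub>class_ring\<^esub> y \<longleftrightarrow> x - y \<in> I"
  using ring.quotient_eq_iff_same_a_r_cos[OF class_ring.ring_axioms I, of x y]
  by (simp add: class_ring_simps)

text \<open>Applied once per inclusion, this makes elements that separate the members of a chain of primes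
  algebraically independent modulo the smallest one.\<close>

lemma prime_step_coeffs_zero:
  fixes P Q :: "'r::comm_ring_1 set"
  assumes P: "primeideal P class_ring" and Q: "Ideal.ideal Q class_ring" and "P \<subseteq> Q" "f \<notin> P" "f \<in> Q"
    and "(\<Sum>a\<le>m. g a * f ^ a) \<in> P" "\<And>a. a \<le> m \<Longrightarrow> g a \<in> Q \<Longrightarrow> g a = 0" "a \<le> m"
  shows "g a = 0"
  using assms(6-)
proof (induction m arbitrary: g a)
  case 0
  then show ?case using \<open>P \<subseteq> Q\<close> by auto
next
  case (Suc m)
  let ?R = "\<Sum>a\<le>m. g (Suc a) * f ^ a"
  \<comment> \<open>Since \<open>f\<close> lies in \<open>Q\<close>, the constant term lies in
    \<open>Q\<close> as well and so vanishes; primality of \<open>P\<close> then cancels one factor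
    \<open>f\<close> from the rest.\<close>
  have split: "(\<Sum>a\<le>Suc m. g a * f ^ a) = g 0 + ?R * f"
    by (simp add: sum.atMost_Suc_shift sum_distrib_left sum_distrib_right algebra_simps del: sum.atMost_Suc)
  have "g 0 + ?R * f \<in> Q" using Suc.prems(1) \<open>P \<subseteq> Q\<close> split by auto
  from ideal_minus[OF Q this ideal_mult[OF Q \<open>f \<in> Q\<close>, of ?R]] have "g 0 \<in> Q" by simp
  then have g0: "g 0 = 0" using Suc.prems(2) by blast
  then have "?R * f \<in> P" using Suc.prems(1) split by simp
  then have R: "?R \<in> P" using prime_class_ringD[OF P] \<open>f \<notin> P\<close> by blast
  have "g (Suc b) = 0" if "b \<le> m" for b
    by (rule Suc.IH[of "\<lambda>a. g (Suc a)", OF R]) (use Suc.prems(2) that in auto)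
  with g0 Suc.prems(3) show ?case by (cases a) auto
qed

text \<open>More vectors than coordinates are dependent, by Gaussian elimination: a pivot
  \<open>j0\<close> clears the coordinate \<open>x\<close> from the others, and its own coefficient
  is recovered afterwards as \<open>- e\<close>.\<close>

lemma exists_dependence:
  fixes f :: "'i \<Rightarrow> 'x \<Rightarrow> 'k::field"
  assumes "finite R" "finite J" "card R < card J"
  shows "\<exists>c. (\<exists>j\<in>J. c j \<noteq> 0) \<and> (\<forall>x\<in>R. (\<Sum>j\<in>J. c j * f j x) = 0)"
  using assms
proof (induction R arbitrary: J f rule: finite_induct)
  case empty
  then have "J \<noteq> {}" by auto
  then show ?case by (intro exI[of _ "\<lambda>_. 1"]) auto
next
  case (insert x R)
  show ?case
  proof (cases "\<forall>j\<in>J. f j x = 0")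
    case True
    have "card R < card J" using insert by simp
    from insert.IH[OF insert.prems(1) this] obtain c where
      "\<exists>j\<in>J. c j \<noteq> 0" "\<forall>x\<in>R. (\<Sum>j\<in>J. c j * f j x) = 0" by blast
    with True show ?thesis by (intro exI[of _ c]) auto
  next
    case False
    then obtain j0 where j0: "j0 \<in> J" "f j0 x \<noteq> 0" by blast
    have "card R < card (J - {j0})" using insert j0 by simp
    from insert.IH[OF _ this, of "\<lambda>j y. f j y - f j x / f j0 x * f j0 y"] insert.prems(1)
    obtain c where c: "\<exists>j\<in>J - {j0}. c j \<noteq> 0"
      "\<And>y. y \<in> R \<Longrightarrow> (\<Sum>j\<in>J - {j0}. c j * (f j y - f j x / f j0 x * f j0 y)) = 0" by auto
    define e where "e = (\<Sum>j\<in>J - {j0}. c j * (f j x / f j0 x))"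
    define c' where "c' = c(j0 := - e)"
    have sum': "(\<Sum>j\<in>J. c' j * f j y) = (\<Sum>j\<in>J - {j0}. c j * (f j y - f j x / f j0 x * f j0 y))" for y
    proof -
      have "(\<Sum>j\<in>J. c' j * f j y) = - e * f j0 y + (\<Sum>j\<in>J - {j0}. c j * f j y)"
        by (subst sum.remove[OF insert.prems(1) j0(1)]) (simp add: c'_def)
      then show ?thesis
        by (simp add: e_def sum_distrib_right sum_subtractf right_diff_distrib mult.assoc)
    qed
    have "(\<Sum>j\<in>J. c' j * f j y) = 0" if "y \<in> insert x R" for y
      unfolding sum' using that c(2) j0(2) by auto
    moreover have "\<exists>j\<in>J. c' j \<noteq> 0" using c(1) by (auto simp: c'_def)
    ultimately show ?thesis by blast
  qed
qed

subsection \<open>The affine Hilbert function\<close>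

lemma deg_le_zero: "0 \<in> deg_le i"
  by (simp add: deg_le_def)

lemma deg_le_add: "p \<in> deg_le i \<Longrightarrow> q \<in> deg_le i \<Longrightarrow> p + q \<in> deg_le i"
  unfolding deg_le_def using keys_add[of p q] by blast

lemma deg_le_uminus: "p \<in> deg_le i \<Longrightarrow> - p \<in> deg_le i"
  by (simp add: deg_le_def in_keys_iff)

lemma deg_le_mono: "i \<le> j \<Longrightarrow> deg_le i \<subseteq> deg_le j"
  by (auto simp: deg_le_def)

lemma deg_le_mult:
  assumes "p \<in> deg_le i" "q \<in> deg_le j"
  shows "p * q \<in> deg_le (i + j)"
proof -
  have "tdeg c \<le> i + j" if c: "c \<in> Poly_Mapping.keys (p * q)" for c
  proof -
    obtain a b where "c = a + b" "a \<in> Poly_Mapping.keys p" "b \<in> Poly_Mapping.keys q"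
      using c keys_mult[of p q] by blast
    then show ?thesis using assms by (auto simp: deg_le_def weight_add intro: add_mono)
  qed
  then show ?thesis by (simp add: deg_le_def)
qed

lemma deg_le_single: "tdeg c \<le> i \<Longrightarrow> Poly_Mapping.single c x \<in> deg_le i"
  by (simp add: deg_le_def)

lemma deg_le_scale: "p \<in> deg_le i \<Longrightarrow> Poly_Mapping.single 0 c * p \<in> deg_le i"
  using deg_le_mult[OF deg_le_single[of 0 0 c], of p i] by simp

lemma deg_le_sum: "(\<And>s. s \<in> S \<Longrightarrow> f s \<in> deg_le i) \<Longrightarrow> sum f S \<in> deg_le i"
  by (induction S rule: infinite_finite_induct) (auto intro: deg_le_zero deg_le_add)

lemma deg_le_power: "p \<in> deg_le i \<Longrightarrow> p ^ n \<in> deg_le (i * n)"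
proof (induction n)
  case 0
  show ?case unfolding power_0 single_one[symmetric] by (rule deg_le_single) simp
next
  case (Suc n)
  then show ?case using deg_le_mult[of p i "p ^ n" "i * n"] by simp
qed

lemma deg_le_cover:
  obtains i where "(p :: ('n::finite, 'k::field) mvpoly) \<in> deg_le i"
proof
  \<comment> \<open>\<open>insert 0\<close> keeps \<open>Max\<close> defined for the zero
    polynomial.\<close>
  show "p \<in> deg_le (Max (insert 0 (tdeg ` Poly_Mapping.keys p)))"
    by (auto simp: deg_le_def)
qed

text \<open>Bridge from the dimension of the quotient module record to plain polynomials:
  \<open>gen\<close> and \<open>indep\<close> say that the monomials with exponents in
  \<open>R\<close> form a basis modulo \<open>I\<close>. All operations of the record are first
  rewritten in terms of the cosets \<open>cs x\<close>.\<close>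

lemma affine_hilbert_fun_eq_card:
  fixes I :: "('n::finite, 'k::field) mvpoly set"
  assumes I: "Ideal.ideal I class_ring" and fin: "finite R" and R: "\<And>r. r \<in> R \<Longrightarrow> tdeg r \<le> i"
    and gen: "\<And>p. p \<in> deg_le i \<Longrightarrow> \<exists>q. Poly_Mapping.keys q \<subseteq> R \<and> p - q \<in> I"
    and indep: "\<And>q. Poly_Mapping.keys q \<subseteq> R \<Longrightarrow> q \<in> I \<Longrightarrow> q = 0"
  shows "affine_hilbert_fun I i = card R"
proof -
  define V where "V = quot_module (mvpoly_module\<lparr>carrier := deg_le i\<rparr>) (I \<inter> deg_le i)"
  define cs where "cs x = {y. y - x \<in> I \<inter> deg_le i}" for x
  have cs: "I \<inter> deg_le i +>\<^bsub>mvpoly_module\<lparr>carrier := deg_le i\<rparr>\<^esub> x = cs x" for x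
  proof -
    have "(y - x \<in> I \<inter> deg_le i) \<longleftrightarrow> (\<exists>n\<in>I \<inter> deg_le i. y = n + x)" for y
      by (metis add_diff_cancel diff_add_cancel)
    then show ?thesis by (auto simp: a_r_coset_def' mvpoly_module_def cs_def)
  qed
  have self: "x \<in> cs x" for x by (simp add: cs_def ideal_zero[OF I] deg_le_zero)
  have diff: "p - q \<in> deg_le i" if "p \<in> deg_le i" "q \<in> deg_le i" for p q :: "('n, 'k) mvpoly"
    using deg_le_add[OF that(1) deg_le_uminus[OF that(2)]] by simp
  have cs_sub: "cs x \<subseteq> cs y" if "x - y \<in> I" "x \<in> deg_le i" "y \<in> deg_le i" for x y
  proof
    fix z assume "z \<in> cs x"
    then have z: "z - x \<in> I" "z - x \<in> deg_le i" by (auto simp: cs_def)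
    have "(z - x) + (x - y) \<in> I" "(z - x) + (x - y) \<in> deg_le i"
      by (rule ideal_add[OF I z(1) that(1)], rule deg_le_add[OF z(2) diff[OF that(2,3)]])
    then show "z \<in> cs y" by (simp add: cs_def)
  qed
  have cs_eq: "cs x = cs y \<longleftrightarrow> x - y \<in> I" if "x \<in> deg_le i" "y \<in> deg_le i" for x y
  proof
    assume "cs x = cs y"
    then have "x \<in> cs y" using self[of x] by simp
    then show "x - y \<in> I" by (simp add: cs_def)
  next
    assume xy: "x - y \<in> I"
    have "y - x \<in> I" using ideal_minus[OF I ideal_zero[OF I] xy] by simp
    then show "cs x = cs y" using cs_sub xy that by blast
  qed
  have carrier_V: "carrier V = cs ` deg_le i"
    unfolding V_def quot_module_def by (auto simp: A_RCOSETS_def' cs)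
  have zero_V: "\<zero>\<^bsub>V\<^esub> = cs 0" by (auto simp: V_def quot_module_def cs_def)
  have add_V: "cs x \<oplus>\<^bsub>V\<^esub> cs y = cs (x + y)" for x y
  proof -
    have "(\<exists>a\<in>cs x. \<exists>b\<in>cs y. z = a + b) \<longleftrightarrow> z \<in> cs (x + y)" for z
    proof
      assume "\<exists>a\<in>cs x. \<exists>b\<in>cs y. z = a + b"
      then obtain a b where ab: "a \<in> cs x" "b \<in> cs y" "z = a + b" by blast
      then have "(a - x) + (b - y) \<in> I \<inter> deg_le i"
        by (auto simp: cs_def intro: ideal_add[OF I] deg_le_add)
      then show "z \<in> cs (x + y)" using ab(3) by (simp add: cs_def algebra_simps)
    next
      assume "z \<in> cs (x + y)"
      then have "z - y \<in> cs x" by (simp add: cs_def algebra_simps)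
      then show "\<exists>a\<in>cs x. \<exists>b\<in>cs y. z = a + b" using self[of y] by (metis diff_add_cancel)
    qed
    then show ?thesis by (auto simp: V_def quot_module_def set_add_def' mvpoly_module_def)
  qed
  have smult_V: "c \<odot>\<^bsub>V\<^esub> cs x = cs (Poly_Mapping.single 0 c * x)" if "x \<in> deg_le i" for c x
  proof -
    have "cs (Poly_Mapping.single 0 c * y) = cs (Poly_Mapping.single 0 c * x)" if "y \<in> cs x" for y
    proof -
      have y: "y - x \<in> I" "y - x \<in> deg_le i" using that by (auto simp: cs_def)
      then have "y \<in> deg_le i" using deg_le_add[OF y(2) \<open>x \<in> deg_le i\<close>] by simp
      moreover have "Poly_Mapping.single 0 c * y - Poly_Mapping.single 0 c * x \<in> I"
        unfolding right_diff_distrib[symmetric] by (rule ideal_mult[OF I y(1)])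
      ultimately show ?thesis using cs_eq deg_le_scale \<open>x \<in> deg_le i\<close> by blast
    qed
    \<comment> \<open>The union over representatives in \<open>quot_module\<close> collapses, since
      all its members are the same coset.\<close>
    moreover have "c \<odot>\<^bsub>V\<^esub> cs x = (\<Union>y\<in>cs x. cs (Poly_Mapping.single 0 c * y))"
      by (simp add: V_def quot_module_def cs) (simp add: mvpoly_module_def)
    ultimately show ?thesis using self by blast
  qed
  note V_simps = carrier_V zero_V add_V smult_V
  have "abelian_group V"
  proof (rule abelian_groupI)
    fix A B C
    assume "A \<in> carrier V"
    then obtain x where x: "x \<in> deg_le i" "A = cs x" by (auto simp: carrier_V)
    show "\<zero>\<^bsub>V\<^esub> \<oplus>\<^bsub>V\<^esub> A = A" by (simp add: x zero_V add_V)
    have "cs (- x) \<oplus>\<^bsub>V\<^esub> A = \<zero>\<^bsub>V\<^esub>" by (simp add: x zero_V add_V)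
    then show "\<exists>B\<in>carrier V. B \<oplus>\<^bsub>V\<^esub> A = \<zero>\<^bsub>V\<^esub>" using x deg_le_uminus by (auto simp: carrier_V)
    assume "B \<in> carrier V"
    then obtain y where y: "y \<in> deg_le i" "B = cs y" by (auto simp: carrier_V)
    show "A \<oplus>\<^bsub>V\<^esub> B \<in> carrier V" using x y deg_le_add by (auto simp: V_simps)
    show "A \<oplus>\<^bsub>V\<^esub> B = B \<oplus>\<^bsub>V\<^esub> A" by (simp add: x y add_V add.commute)
    assume "C \<in> carrier V"
    then obtain z where z: "z \<in> deg_le i" "C = cs z" by (auto simp: carrier_V)
    show "A \<oplus>\<^bsub>V\<^esub> B \<oplus>\<^bsub>V\<^esub> C = A \<oplus>\<^bsub>V\<^esub> (B \<oplus>\<^bsub>V\<^esub> C)" by (simp add: x y z add_V add.assoc)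
  next
    show "\<zero>\<^bsub>V\<^esub> \<in> carrier V" by (auto simp: V_simps deg_le_zero)
  qed
  then have "Module.module (class_ring :: 'k ring) V"
  proof (intro moduleI)
    fix a b :: 'k and A B
    assume "A \<in> carrier V"
    then obtain x where x: "x \<in> deg_le i" "A = cs x" by (auto simp: carrier_V)
    show "a \<odot>\<^bsub>V\<^esub> A \<in> carrier V" using x deg_le_scale by (auto simp: V_simps)
    show "(a \<oplus>\<^bsub>class_ring\<^esub> b) \<odot>\<^bsub>V\<^esub> A = a \<odot>\<^bsub>V\<^esub> A \<oplus>\<^bsub>V\<^esub> b \<odot>\<^bsub>V\<^esub> A"
      using x by (simp add: V_simps single_add distrib_right)
    show "(a \<otimes>\<^bsub>class_ring\<^esub> b) \<odot>\<^bsub>V\<^esub> A = a \<odot>\<^bsub>V\<^esub> (b \<odot>\<^bsub>V\<^esub> A)"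
      using x deg_le_scale[OF x(1), of b] by (simp add: V_simps mult_single mult.assoc[symmetric])
    show "\<one>\<^bsub>class_ring\<^esub> \<odot>\<^bsub>V\<^esub> A = A" using x by (simp add: V_simps)
    assume "B \<in> carrier V"
    then obtain y where y: "y \<in> deg_le i" "B = cs y" by (auto simp: carrier_V)
    show "a \<odot>\<^bsub>V\<^esub> (A \<oplus>\<^bsub>V\<^esub> B) = a \<odot>\<^bsub>V\<^esub> A \<oplus>\<^bsub>V\<^esub> a \<odot>\<^bsub>V\<^esub> B"
      using x y deg_le_add[OF x(1) y(1)] by (simp add: V_simps distrib_left)
  qed (rule class_cring.cring_axioms)
  then interpret V: vectorspace "class_ring :: 'k ring" V
    by (intro vectorspace.intro class_field)
  have finsum: "(\<Oplus>\<^bsub>V\<^esub>s\<in>S. cs (f s)) = cs (sum f S)" if "finite S" "\<And>s. s \<in> S \<Longrightarrow> f s \<in> deg_le i"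
    for S :: "('n \<Rightarrow>\<^sub>0 nat) set" and f
    using that
  proof (induction S rule: finite_induct)
    case empty
    then show ?case by (simp add: zero_V)
  next
    case (insert s S)
    then have "(\<lambda>s. cs (f s)) \<in> S \<rightarrow> carrier V" "cs (f s) \<in> carrier V" by (auto simp: carrier_V)
    with insert show ?case by (simp add: add_V)
  qed
  define b :: "('n \<Rightarrow>\<^sub>0 nat) \<Rightarrow> ('n, 'k) mvpoly set" where "b r = cs (monom_t r)" for r
  have m: "monom_t r \<in> deg_le i" if "r \<in> R" for r
    unfolding monom_t_def by (rule deg_le_single[OF R[OF that]])
  have lookup_sum_single: "Poly_Mapping.lookup (\<Sum>r\<in>S. Poly_Mapping.single r (a r)) s = (a s when s \<in> S)"
    if "finite S" for S :: "('n \<Rightarrow>\<^sub>0 nat) set" and a :: "_ \<Rightarrow> 'k" and s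
    using that by (simp add: lookup_sum lookup_single when_def)
  have inj: "inj_on b R"
  proof (rule inj_onI)
    fix r r' assume *: "r \<in> R" "r' \<in> R" "b r = b r'"
    then have "cs (monom_t r) = cs (monom_t r')" by (simp add: b_def)
    then have "monom_t r - monom_t r' \<in> I" using cs_eq[OF m[OF *(1)] m[OF *(2)]] by blast
    moreover have "Poly_Mapping.keys (monom_t r - monom_t r' :: ('n, 'k) mvpoly) \<subseteq> R"
      using keys_diff[of "monom_t r" "monom_t r' :: ('n, 'k) mvpoly"] * by (auto simp: monom_t_def)
    ultimately have "monom_t r - (monom_t r' :: ('n, 'k) mvpoly) = 0" using indep by blast
    then have "Poly_Mapping.lookup (monom_t r :: ('n, 'k) mvpoly) r = Poly_Mapping.lookup (monom_t r') r"
      by simp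
    then show "r = r'" by (auto simp: monom_t_def lookup_single when_def split: if_splits)
  qed
  have lc: "V.lincomb a (b ` S) = cs (\<Sum>r\<in>S. Poly_Mapping.single r (a (b r)))" if "S \<subseteq> R" for a S
  proof -
    have S: "finite S" "inj_on b S" using that fin inj finite_subset inj_on_subset by blast+
    have "V.lincomb a (b ` S) = (\<Oplus>\<^bsub>V\<^esub>r\<in>S. a (b r) \<odot>\<^bsub>V\<^esub> b r)"
      unfolding V.lincomb_def
    proof (rule V.finsum_reindex[OF _ S(2)])
      show "(\<lambda>v. a v \<odot>\<^bsub>V\<^esub> v) \<in> b ` S \<rightarrow> carrier V"
        using smult_V[OF m] deg_le_scale[OF m] that by (fastforce simp: b_def carrier_V)
    qed
    also have "\<dots> = (\<Oplus>\<^bsub>V\<^esub>r\<in>S. cs (Poly_Mapping.single r (a (b r))))"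
    proof (rule V.finsum_cong')
      show "(\<lambda>r. cs (Poly_Mapping.single r (a (b r)))) \<in> S \<rightarrow> carrier V"
        using that deg_le_single[OF R] by (fastforce simp: carrier_V)
      fix r assume "r \<in> S"
      then have "r \<in> R" using that by blast
      have "a (b r) \<odot>\<^bsub>V\<^esub> b r = cs (Poly_Mapping.single 0 (a (b r)) * monom_t r)"
        unfolding b_def by (rule smult_V[OF m[OF \<open>r \<in> R\<close>]])
      then show "a (b r) \<odot>\<^bsub>V\<^esub> b r = cs (Poly_Mapping.single r (a (b r)))"
        by (simp add: monom_t_def mult_single)
    qed simp
    also have "\<dots> = cs (\<Sum>r\<in>S. Poly_Mapping.single r (a (b r)))"
      by (rule finsum[OF S(1)]) (use that deg_le_single[OF R] in blast)
    finally show ?thesis .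
  qed
  have bR: "b ` R \<subseteq> carrier V" using m by (auto simp: b_def carrier_V)
  have "V.basis (b ` R)"
    unfolding V.basis_def
  proof (intro conjI bR)
    show "V.lin_indpt (b ` R)"
    proof
      assume "V.lin_dep (b ` R)"
      then obtain B a v where B: "finite B" "B \<subseteq> b ` R" "V.lincomb a B = \<zero>\<^bsub>V\<^esub>" "v \<in> B" "a v \<noteq> 0"
        unfolding V.lin_dep_def by auto
      then obtain S where S: "S \<subseteq> R" "B = b ` S" by (metis subset_image_iff)
      let ?q = "\<Sum>r\<in>S. Poly_Mapping.single r (a (b r))"
      have finS: "finite S" using S(1) fin finite_subset by blast
      have "cs ?q = cs 0" using lc[OF S(1), of a] B(3) S(2) by (simp add: zero_V)
      moreover have "?q \<in> deg_le i" using S(1) R by (intro deg_le_sum deg_le_single) blast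
      ultimately have "?q \<in> I" using cs_eq[OF _ deg_le_zero, of ?q] by simp
      moreover have "Poly_Mapping.keys ?q \<subseteq> R"
        using S(1) lookup_sum_single[OF finS] by (auto simp: in_keys_iff when_def split: if_splits)
      ultimately have "?q = 0" using indep by blast
      moreover obtain r where "r \<in> S" "v = b r" using B(4) S(2) by blast
      ultimately show False using lookup_sum_single[OF finS, of "\<lambda>r. a (b r)" r] B(5) by simp
    qed
    show "V.gen_set (b ` R)"
    proof
      show "V.span (b ` R) \<subseteq> carrier V" by (rule V.span_is_subset2[OF bR])
      show "carrier V \<subseteq> V.span (b ` R)"
      proof
        fix C assume "C \<in> carrier V"
        then obtain p where p: "p \<in> deg_le i" "C = cs p" by (auto simp: carrier_V)
        obtain q where q: "Poly_Mapping.keys q \<subseteq> R" "p - q \<in> I" using gen[OF p(1)] by blast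
        have "q \<in> deg_le i" using q(1) R by (auto simp: deg_le_def)
        then have C: "C = cs q" using cs_eq p q(2) by simp
        \<comment> \<open>Linear combinations take coefficients indexed by vectors, here cosets, so
          the exponent is recovered through the inverse of the injective \<open>b\<close>.\<close>
        define a where "a v = Poly_Mapping.lookup q (inv_into R b v)" for v
        have "q = (\<Sum>r\<in>R. Poly_Mapping.single r (a (b r)))"
        proof (rule poly_mapping_eqI)
          fix s
          have "Poly_Mapping.lookup q s = (a (b s) when s \<in> R)"
            using q(1) inj by (auto simp: a_def when_def in_keys_iff)
          then show "Poly_Mapping.lookup q s = Poly_Mapping.lookup (\<Sum>r\<in>R. Poly_Mapping.single r (a (b r))) s"
            using lookup_sum_single[OF fin, of "\<lambda>r. a (b r)" s] by simp
        qed
        then have "C = V.lincomb a (b ` R)" using C lc[of R a] by simp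
        moreover have "finite (b ` R)" "a \<in> b ` R \<rightarrow> carrier class_ring" using fin by auto
        ultimately show "C \<in> V.span (b ` R)" unfolding V.span_def
          by (intro CollectI exI conjI) (assumption | rule subset_refl)+
      qed
    qed
  qed
  then have "V.dim = card (b ` R)" using fin by (intro V.dim_basis) auto
  then show ?thesis using inj by (simp add: affine_hilbert_fun_def V_def card_image)
qed

subsection \<open>Binomial ideals\<close>

definition binomial_ideal :: "(int ^ 'n) set \<Rightarrow> ('n::finite, 'k::field) mvpoly set" where
  "binomial_ideal A = Idl\<^bsub>class_ring\<^esub> {monom_t (pos_part a) - monom_t (neg_part a) | a. a \<in> A}"

lemma monom_t_mult: "monom_t b * monom_t c = monom_t (b + c)"
  by (simp add: monom_t_def mult_single)

text \<open>The projection onto the span of the representatives along the ideal; its kernel is the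
  ideal by \<open>in_binomial_ideal_iff\<close>.\<close>

definition nform :: "(int ^ 'n) set \<Rightarrow> ('n::finite, 'k::field) mvpoly \<Rightarrow> ('n, 'k) mvpoly" where
  "nform A = plift (\<lambda>c x. Poly_Mapping.single (rep A c) x)"

lemma nform_add: "nform A (p + q) = nform A p + nform A q"
  unfolding nform_def by (rule plift_add) (auto simp: single_add)

lemma nform_zero [simp]: "nform A 0 = 0"
  by (simp add: nform_def)

lemma nform_diff: "nform A (p - q) = nform A p - nform A q"
  using nform_add[of A "p - q" q] by simp

lemma nform_sum: "nform A (sum f S) = (\<Sum>s\<in>S. nform A (f s))"
  by (induction S rule: infinite_finite_induct) (auto simp: nform_add)

lemma nform_single [simp]: "nform A (Poly_Mapping.single c x) = Poly_Mapping.single (rep A c) x"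
  unfolding nform_def by (rule plift_single) simp

text \<open>Representatives have minimal degree in their class, so passing to the normal form never
  raises the degree.\<close>

lemma keys_nform:
  assumes "p \<in> deg_le i"
  shows "Poly_Mapping.keys (nform A p) \<subseteq> {r. rep A r = r \<and> tdeg r \<le> i}"
proof -
  have "Poly_Mapping.keys (nform A p) \<subseteq> (\<Union>c\<in>Poly_Mapping.keys p. {rep A c})"
    unfolding nform_def plift_def by (rule order_trans[OF keys_sum]) (auto split: if_splits)
  moreover have "tdeg (rep A c) \<le> i" if "c \<in> Poly_Mapping.keys p" for c
    using that assms order_trans[OF rep_le[OF mcong.refl]] by (auto simp: deg_le_def)
  ultimately show ?thesis by auto
qed

lemma nform_id:
  assumes "Poly_Mapping.keys p \<subseteq> {r. rep A r = r}"
  shows "nform A p = p"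
proof -
  have "nform A p = (\<Sum>c\<in>Poly_Mapping.keys p. Poly_Mapping.single c (Poly_Mapping.lookup p c))"
    unfolding nform_def plift_def by (rule sum.cong) (use assms in auto)
  then show ?thesis by (simp add: sum_single_lookup)
qed

lemma ideal_binomial_ideal: "Ideal.ideal (binomial_ideal A) class_ring"
  unfolding binomial_ideal_def by (rule ideal_Idl)

lemma mcong_imp_binomial_ideal: "mcong A b c \<Longrightarrow> monom_t b - monom_t c \<in> binomial_ideal A"
proof (induction rule: mcong.induct)
  case (refl c)
  then show ?case using ideal_zero[OF ideal_binomial_ideal] by simp
next
  case (gen a u)
  then have "monom_t (pos_part a) - monom_t (neg_part a) \<in> binomial_ideal A"
    unfolding binomial_ideal_def by (intro subsetD[OF Idl_superset] CollectI exI conjI) (rule HOL.refl)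
  from ideal_mult[OF ideal_binomial_ideal this, of "monom_t u"] show ?case
    by (simp add: right_diff_distrib monom_t_mult)
next
  case (sym b c)
  from ideal_minus[OF ideal_binomial_ideal ideal_zero[OF ideal_binomial_ideal] sym.IH] show ?case by simp
next
  case (trans b c e)
  from ideal_add[OF ideal_binomial_ideal trans.IH] show ?case by simp
qed

lemma diff_nform_in_binomial_ideal: "p - nform A p \<in> binomial_ideal A"
proof -
  have "p - nform A p = (\<Sum>c\<in>Poly_Mapping.keys p.
      Poly_Mapping.single 0 (Poly_Mapping.lookup p c) * (monom_t c - monom_t (rep A c)))"
    by (subst (1) sum_single_lookup[symmetric])
      (simp add: nform_def plift_def monom_t_def right_diff_distrib mult_single sum_subtractf)
  also have "\<dots> \<in> binomial_ideal A"
    by (intro ideal_sum[OF ideal_binomial_ideal] ideal_mult[OF ideal_binomial_ideal]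
        mcong_imp_binomial_ideal rep_mcong)
  finally show ?thesis .
qed

lemma in_binomial_ideal_iff: "p \<in> binomial_ideal A \<longleftrightarrow> nform A p = 0"
proof
  assume "nform A p = 0"
  then show "p \<in> binomial_ideal A" using diff_nform_in_binomial_ideal[of p A] by simp
next
  \<comment> \<open>The factor \<open>q\<close> makes closure under multiplication immediate; for
    the kernel of \<open>nform\<close> itself it is not visible in advance.\<close>
  let ?J = "{p :: ('a, 'b) mvpoly. \<forall>q. nform A (q * p) = 0}"
  have "binomial_ideal A \<subseteq> ?J"
    unfolding binomial_ideal_def
  proof (rule Idl_minimal)
    show "Ideal.ideal ?J class_ring"
      by (rule ideal_class_ringI)
        (auto simp: distrib_left nform_add mult.assoc[symmetric])
    show "{monom_t (pos_part a) - monom_t (neg_part a) | a. a \<in> A} \<subseteq> ?J"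
    proof clarify
      fix a and q :: "('a, 'b) mvpoly" assume a: "a \<in> A"
      have mono: "nform A (q * monom_t u)
          = (\<Sum>c\<in>Poly_Mapping.keys q. Poly_Mapping.single (rep A (c + u)) (Poly_Mapping.lookup q c))" for u
        by (subst (1) sum_single_lookup[of q, symmetric])
          (simp add: sum_distrib_right monom_t_def mult_single nform_sum)
      have "rep A (c + pos_part a) = rep A (c + neg_part a)" for c
        by (simp add: rep_eq_iff mcong.gen[OF a])
      then show "nform A (q * (monom_t (pos_part a) - monom_t (neg_part a))) = 0"
        by (simp add: right_diff_distrib nform_diff mono)
    qed
  qed
  moreover assume "p \<in> binomial_ideal A"
  ultimately have "nform A (1 * p) = 0" by blast
  then show "nform A p = 0" by simp
qed

lemma finite_rep_tdeg_le: "finite {r. rep A r = r \<and> tdeg r \<le> i}"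
  by (rule finite_subset[OF _ finite_weight_le[of "\<lambda>_. 1" i]]) auto

lemma affine_hilbert_fun_binomial_ideal:
  "affine_hilbert_fun (binomial_ideal A :: ('n::finite, 'k::field) mvpoly set) i
    = card {r. rep A r = r \<and> tdeg r \<le> i}"
proof (rule affine_hilbert_fun_eq_card[OF ideal_binomial_ideal finite_rep_tdeg_le])
  fix p :: "('n, 'k) mvpoly" assume "p \<in> deg_le i"
  then show "\<exists>q. Poly_Mapping.keys q \<subseteq> {r. rep A r = r \<and> tdeg r \<le> i} \<and> p - q \<in> binomial_ideal A"
    using keys_nform diff_nform_in_binomial_ideal by blast
next
  fix q :: "('n, 'k) mvpoly"
  assume "Poly_Mapping.keys q \<subseteq> {r. rep A r = r \<and> tdeg r \<le> i}" "q \<in> binomial_ideal A"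
  then show "q = 0" using nform_id[of q A] by (auto simp: in_binomial_ideal_iff)
qed auto

subsection \<open>Krull dimension\<close>

text \<open>Take \<open>f\<close> in the first gap of the chain and \<open>g\<close> in the second.
  The products f^a g^b with a, b at most m number (m+1)^2 but have degree linear in m, so linear
  growth forces a dependence modulo the ideal. Primality then makes all its coefficients
  vanish.\<close>

lemma no_prime_chain_of_linear_growth:
  fixes P :: "nat \<Rightarrow> ('n::finite, 'k::field) mvpoly set"
  assumes growth: "\<And>i. real (card {r. rep A r = r \<and> tdeg r \<le> i}) \<le> K * real i + C"
    and prime: "\<And>i. i \<le> 2 \<Longrightarrow> primeideal (P i) class_ring"
    and chain: "P 0 \<subset> P 1" "P 1 \<subset> P 2" and "binomial_ideal A \<subseteq> P 0"
  shows False
proof -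
  obtain f g where f: "f \<in> P 1" "f \<notin> P 0" and g: "g \<in> P 2" "g \<notin> P 1" using chain by blast
  obtain ef eg where ef: "f \<in> deg_le ef" and eg: "g \<in> deg_le eg" using deg_le_cover by metis
  let ?e = "ef + eg"
  \<comment> \<open>Chosen so that K e m + C is at most m^2 + m, which is less than (m+1)^2.\<close>
  define m where "m = nat \<lceil>\<bar>K\<bar> * real ?e + \<bar>C\<bar>\<rceil>"
  let ?R = "{r. rep A r = r \<and> tdeg r \<le> ?e * m}"
  let ?J = "{..m} \<times> {..m}"
  define h where "h = (\<lambda>(a, b). f ^ a * g ^ b)"
  have h: "h j \<in> deg_le (?e * m)" if jJ: "j \<in> ?J" for j
  proof -
    obtain a b where j: "j = (a, b)" "a \<le> m" "b \<le> m" using jJ by auto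
    have "h j \<in> deg_le (ef * a + eg * b)"
      unfolding j h_def by (simp add: deg_le_mult deg_le_power ef eg)
    moreover have "ef * a + eg * b \<le> ?e * m" unfolding distrib_right using j by (intro add_mono mult_left_mono) auto
    ultimately show ?thesis using deg_le_mono by blast
  qed
  have "real (card ?R) < real (card ?J)"
  proof -
    have m: "\<bar>K\<bar> * real ?e + \<bar>C\<bar> \<le> real m" unfolding m_def by linarith
    have "real (card ?R) \<le> K * real (?e * m) + C" by (rule growth)
    also have "\<dots> \<le> (\<bar>K\<bar> * real ?e + \<bar>C\<bar>) * real m + \<bar>C\<bar>"
    proof -
      have "K * (real ?e * real m) \<le> \<bar>K\<bar> * (real ?e * real m)" by (intro mult_right_mono) auto
      moreover have "0 \<le> \<bar>C\<bar> * real m" by simp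
      moreover have "C \<le> \<bar>C\<bar>" by (rule abs_ge_self)
      ultimately show ?thesis 
        unfolding of_nat_mult distrib_right[of "\<bar>K\<bar> * real ?e" "\<bar>C\<bar>" "real m"] mult.assoc by linarith
    qed
    also have "\<dots> \<le> real m * real m + real m"
    proof (intro add_mono mult_right_mono m)
      have "0 \<le> \<bar>K\<bar> * real ?e" by simp
      with m show "\<bar>C\<bar> \<le> real m" by linarith
    qed simp
    also have "\<dots> < real (card ?J)" by (simp add: algebra_simps)
    finally show ?thesis .
  qed
  then have "card ?R < card ?J" by (simp only: of_nat_less_iff)
  from exists_dependence[OF finite_rep_tdeg_le _ this, of "\<lambda>j. Poly_Mapping.lookup (nform A (h j))"]
  obtain c where c: "\<exists>j\<in>?J. c j \<noteq> 0"
    "\<And>r. r \<in> ?R \<Longrightarrow> (\<Sum>j\<in>?J. c j * Poly_Mapping.lookup (nform A (h j)) r) = 0" by auto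
  let ?s = "\<Sum>j\<in>?J. Poly_Mapping.single 0 (c j) * h j"
  have scale: "nform A (Poly_Mapping.single 0 x * p) = Poly_Mapping.single 0 x * nform A p" for x p
  proof -
    have "nform A (Poly_Mapping.single 0 x * p)
      = (\<Sum>c\<in>Poly_Mapping.keys p. Poly_Mapping.single 0 x * Poly_Mapping.single (rep A c) (Poly_Mapping.lookup p c))"
      by (subst (1) sum_single_lookup[of p, symmetric]) (simp add: sum_distrib_left mult_single nform_sum)
    then show ?thesis by (simp add: nform_def plift_def sum_distrib_left)
  qed
  have lookup_scale: "Poly_Mapping.lookup (Poly_Mapping.single 0 x * p) r = x * Poly_Mapping.lookup p r"
    for x r and p :: "('n, 'k) mvpoly"
    unfolding mult_map_scale_conv_mult[symmetric] by (simp add: map.rep_eq when_def)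
  have "nform A ?s = 0"
  proof (rule poly_mapping_eqI)
    fix r
    have eq: "Poly_Mapping.lookup (nform A ?s) r = (\<Sum>j\<in>?J. c j * Poly_Mapping.lookup (nform A (h j)) r)"
      by (simp only: nform_sum scale lookup_sum lookup_scale)
    show "Poly_Mapping.lookup (nform A ?s) r = Poly_Mapping.lookup 0 r"
    proof (cases "r \<in> ?R")
      case False
      have "Poly_Mapping.lookup (nform A (h j)) r = 0" if "j \<in> ?J" for j
        using contra_subsetD[OF keys_nform[OF h[OF that]] False] by (simp add: in_keys_iff)
      then show ?thesis unfolding eq by simp
    qed (simp only: eq c(2) lookup_zero)
  qed
  then have "?s \<in> P 0" by (intro subsetD[OF assms(5)]) (simp only: in_binomial_ideal_iff)
  \<comment> \<open>Grouped as a polynomial in \<open>f\<close> whose coefficients are polynomials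
    in \<open>g\<close>. The gap from \<open>P 0\<close> to \<open>P 1\<close> reduces it to
    coefficients lying in \<open>P 1\<close>, the gap from \<open>P 1\<close> to \<open>P 2\<close>
    reduces those to constants in \<open>P 2\<close>, and these are zero because \<open>P 2\<close>
    is proper.\<close>
  moreover have "?s = (\<Sum>a\<le>m. (\<Sum>b\<le>m. Poly_Mapping.single 0 (c (a, b)) * g ^ b) * f ^ a)"
    unfolding sum.cartesian_product[symmetric] h_def
    by (simp add: sum.cartesian_product sum_distrib_left sum_distrib_right split_def ac_simps)
  ultimately have s: "(\<Sum>a\<le>m. (\<Sum>b\<le>m. Poly_Mapping.single 0 (c (a, b)) * g ^ b) * f ^ a) \<in> P 0"
    by simp
  have id: "Ideal.ideal (P i) class_ring" if "i \<le> 2" for i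
    using prime[OF that] by (rule primeideal.axioms(1))
  have const: "x = 0" if "Poly_Mapping.single 0 x \<in> P 2" for x
  proof (rule ccontr)
    assume "x \<noteq> 0"
    then have "Poly_Mapping.single 0 (inverse x) * Poly_Mapping.single 0 x = (1 :: ('n, 'k) mvpoly)"
      by (simp add: mult_single)
    then show False using ideal_mult[OF id that, of "Poly_Mapping.single 0 (inverse x)"] prime_class_ring_one[OF prime[of 2]] by simp
  qed
  have inner: "c (a, b) = 0" if "(\<Sum>b\<le>m. Poly_Mapping.single 0 (c (a, b)) * g ^ b) \<in> P 1" "b \<le> m" for a b
  proof -
    have "Poly_Mapping.single 0 (c (a, b)) = (0 :: ('n, 'k) mvpoly)"
      by (rule prime_step_coeffs_zero[OF prime id _ g(2,1) that(1) _ that(2)])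
        (use chain(2) in \<open>auto dest: const\<close>)
    then have "Poly_Mapping.lookup (Poly_Mapping.single 0 (c (a, b)) :: ('n, 'k) mvpoly) 0 = 0" by simp
    then show ?thesis by simp
  qed
  have inner_zero: "(\<Sum>b\<le>m. Poly_Mapping.single 0 (c (a, b)) * g ^ b) = 0"
    if "(\<Sum>b\<le>m. Poly_Mapping.single 0 (c (a, b)) * g ^ b) \<in> P 1" for a
    by (rule sum.neutral) (use inner[OF that] in simp)
  have outer: "(\<Sum>b\<le>m. Poly_Mapping.single 0 (c (a, b)) * g ^ b) = 0" if "a \<le> m" for a
    by (rule prime_step_coeffs_zero[OF prime id psubset_imp_subset[OF chain(1)] f(2,1) s inner_zero that])
      simp_all
  have "c (a, b) = 0" if "a \<le> m" "b \<le> m" for a b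
    by (rule inner[OF _ that(2)]) (simp add: outer[OF that(1)] ideal_zero[OF id])
  with c(1) show False by auto
qed

context no_face
begin

text \<open>The lower bound comes from two explicit primes, the kernels of \<open>\<psi>\<close> and
  of its constant term. The upper bound pulls a chain back to the polynomial ring, where the linear
  growth of the count excludes three members.\<close>

lemma krull_dim_binomial_ideal:
  "krull_dim (class_ring Quot (binomial_ideal A :: ('n, 'k::field) mvpoly set)) = 1"
proof -
  let ?I = "binomial_ideal A :: ('n, 'k) mvpoly set"
  let ?Q = "class_ring Quot ?I"
  interpret I: Ideal.ideal ?I class_ring by (rule ideal_binomial_ideal)
  \<comment> \<open>The substitution of T^(d_i) for t_i, which kills the binomials because the
    generators are orthogonal to \<open>d\<close>.\<close>
  define \<psi> :: "('n, 'k) mvpoly \<Rightarrow> 'k Polynomial.poly"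
    where "\<psi> = plift (\<lambda>c x. Polynomial.monom x (weight d c))"
  have \<psi>_add: "\<psi> (p + q) = \<psi> p + \<psi> q" for p q
    unfolding \<psi>_def by (rule plift_add) (auto simp: add_monom)
  have \<psi>_mult: "\<psi> (p * q) = \<psi> p * \<psi> q" for p q
    unfolding \<psi>_def by (rule plift_mult) (auto simp: add_monom mult_monom weight_add)
  have \<psi>_single: "\<psi> (Poly_Mapping.single c x) = Polynomial.monom x (weight d c)" for c x
    unfolding \<psi>_def by (rule plift_single) simp
  have \<psi>_one: "\<psi> 1 = 1"
    using \<psi>_single[of 0 1] by simp
  \<comment> \<open>As all weights of variables are positive, this is evaluation at the origin; each
    variable lies in its kernel but not in that of \<open>\<psi>\<close>.\<close>
  define \<psi>0 where "\<psi>0 p = Polynomial.poly (\<psi> p) 0" for p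
  have kernel: "?I \<subseteq> {p. \<psi> p = 0}"
    unfolding binomial_ideal_def
  proof (rule Idl_minimal)
    show "Ideal.ideal {p. \<psi> p = 0} class_ring" by (rule ideal_kernel) (auto simp: \<psi>_add \<psi>_mult)
    show "{monom_t (pos_part a) - monom_t (neg_part a) | a. a \<in> A} \<subseteq> {p. \<psi> p = 0}"
    proof clarify
      fix a assume a: "a \<in> A"
      have "int (weight d (pos_part a)) - int (weight d (neg_part a)) = 0"
        using arg_cong[OF ivec_parts[of a], of "dot d"] dot_gen[OF a] by simp
      moreover have "\<psi> (p - q) = \<psi> p - \<psi> q" for p q using \<psi>_add[of "p - q" q] by simp
      ultimately show "\<psi> (monom_t (pos_part a) - monom_t (neg_part a)) = 0"
        by (simp add: monom_t_def \<psi>_single)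
    qed
  qed
  define P where "P n = (if n = (0::nat) then {C \<in> carrier ?Q. \<exists>x. C = ?I +>\<^bsub>class_ring\<^esub> x \<and> \<psi> x = 0}
     else {C \<in> carrier ?Q. \<exists>x. C = ?I +>\<^bsub>class_ring\<^esub> x \<and> \<psi>0 x = 0})" for n
  have P0: "primeideal (P 0) ?Q" unfolding P_def
    using primeideal_quot_kernel[OF ideal_binomial_ideal kernel \<psi>_add \<psi>_mult \<psi>_one] by simp
  have kernel0: "?I \<subseteq> {p. \<psi>0 p = 0}" using kernel by (auto simp: \<psi>0_def)
  have P1: "primeideal (P 1) ?Q" unfolding P_def
    using primeideal_quot_kernel[OF ideal_binomial_ideal kernel0]
    by (simp add: \<psi>0_def \<psi>_add \<psi>_mult \<psi>_one)
  have "P 0 \<subset> P 1"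
  proof
    show "P 0 \<subseteq> P 1" by (auto simp: P_def \<psi>0_def)
    fix j :: 'n
    let ?C = "?I +>\<^bsub>class_ring\<^esub> var_t j"
    have "\<psi> (var_t j) = Polynomial.monom 1 (d j)"
      by (simp add: var_t_def monom_t_def \<psi>_single)
    then have v: "\<psi>0 (var_t j) = 0" "\<psi> (var_t j) \<noteq> 0"
      using d_pos[of j] by (auto simp: \<psi>0_def poly_monom)
    have "?C \<in> carrier ?Q" by (auto simp: FactRing_def A_RCOSETS_def')
    then have "?C \<in> P 1" using v(1) by (auto simp: P_def)
    moreover have "?C \<notin> P 0"
    proof
      assume "?C \<in> P 0"
      then obtain x where x: "?C = ?I +>\<^bsub>class_ring\<^esub> x" "\<psi> x = 0" by (auto simp: P_def)
      then have "var_t j - x \<in> ?I" using quot_coset_eq_iff[OF ideal_binomial_ideal] by blast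
      then have "\<psi> (var_t j - x) = 0" using kernel by blast
      then show False using \<psi>_add[of "var_t j - x" x] x(2) v(2) by simp
    qed
    ultimately show "P 0 \<noteq> P 1" by blast
  qed
  with P0 P1 have one: "(\<forall>i\<le>1::nat. primeideal (P i) ?Q) \<and> (\<forall>i<1::nat. P i \<subset> P (Suc i))"
    by (auto simp: le_Suc_eq)
  have le: "n \<le> 1" if prime: "\<forall>i\<le>n. primeideal (P i) ?Q" and chain: "\<forall>i<n. P i \<subset> P (Suc i)" for n P
  proof (rule ccontr)
    assume "\<not> n \<le> 1"
    then have n: "2 \<le> n" by simp
    obtain C where C: "\<And>i. \<bar>real (card {r. rep A r = r \<and> tdeg r \<le> i}) - real (Max (range d) * card Tor) * real i\<bar> \<le> C"
      using card_rep_tdeg_le by blast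
    \<comment> \<open>Preimages of the primes in the polynomial ring; the inclusions stay strict
      because the projection to the quotient is onto.\<close>
    define P' where "P' i = {x \<in> carrier class_ring. ?I +>\<^bsub>class_ring\<^esub> x \<in> P i}" for i
    have prime': "primeideal (P' i) class_ring" if "i \<le> 2" for i
      unfolding P'_def
      using ring_hom_ring.primeideal_vimage[OF I.rcos_ring_hom_ring class_cring.cring_axioms] prime that n by simp
    have strict: "P' i \<subset> P' (Suc i)" if "i < 2" for i
    proof -
      have "P i \<subset> P (Suc i)" using chain that n by simp
      moreover have "P (Suc i) \<subseteq> carrier ?Q"
        using prime that n
        by (intro additive_subgroup.a_subset ideal.axioms(1) primeideal.axioms(1)) simp
      ultimately show ?thesis unfolding P'_def by (auto simp: FactRing_def A_RCOSETS_def')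
    qed
    show False
    proof (rule no_prime_chain_of_linear_growth[of A "real (Max (range d) * card Tor)" C P'])
      show "real (card {r. rep A r = r \<and> tdeg r \<le> i}) \<le> real (Max (range d) * card Tor) * real i + C" for i
        using C[of i] by linarith
      show "?I \<subseteq> P' 0"
      proof
        fix x assume "x \<in> ?I"
        then have "?I +>\<^bsub>class_ring\<^esub> x = ?I" using I.a_rcos_const by simp
        moreover have "?I \<in> P 0"
        proof -
          have "\<zero>\<^bsub>?Q\<^esub> \<in> P 0"
            using prime by (intro additive_subgroup.zero_closed ideal.axioms(1) primeideal.axioms(1)) simp
          then show ?thesis by (simp add: FactRing_def)
        qed
        ultimately show "x \<in> P' 0" by (simp add: P'_def)
      qed
    qed (use prime' strict[of 0] strict[of 1] in \<open>auto simp: numeral_2_eq_2\<close>)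
  qed
  show ?thesis
    unfolding krull_dim_def
  proof (rule antisym)
    show "Sup {enat n |n. \<exists>P. (\<forall>i\<le>n. primeideal (P i) ?Q) \<and> (\<forall>i<n. P i \<subset> P (Suc i))} \<le> 1"
      by (rule Sup_least) (use le in \<open>auto simp: one_enat_def\<close>)
    show "1 \<le> Sup {enat n |n. \<exists>P. (\<forall>i\<le>n. primeideal (P i) ?Q) \<and> (\<forall>i<n. P i \<subset> P (Suc i))}"
      unfolding one_enat_def 
      by (intro Sup_upper CollectI exI[of _ "1::nat"] conjI HOL.refl exI[of _ P]
          one[THEN conjunct1] one[THEN conjunct2])
  qed
qed

lemma quotient_degree_binomial_ideal:
  "quotient_degree (binomial_ideal A :: ('n, 'k::field) mvpoly set) = real (Max (range d)) * real (card Tor)"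
proof -
  have "(\<lambda>i. real (affine_hilbert_fun (binomial_ideal A :: ('n, 'k) mvpoly set) i) / real i ^ 1)
      \<longlonglongrightarrow> real (Max (range d)) * real (card Tor)"
    unfolding affine_hilbert_fun_binomial_ideal using card_rep_tdeg_le_limit by simp
  from limI[OF this] show ?thesis
    by (simp add: quotient_degree_def krull_dim_binomial_ideal one_enat_def)
qed

end

subsection \<open>Determinants of tuples of lattice vectors\<close>

text \<open>\<open>e\<close> supplies an order of the coordinates, which the index type lacks. It
  stays a parameter so that a chosen row can be put last.\<close>

abbreviation tuple_mat :: "(nat \<Rightarrow> 'n) \<Rightarrow> (nat \<Rightarrow> int ^ 'n) \<Rightarrow> int mat" where
  "tuple_mat e w \<equiv> Matrix.mat CARD('n) CARD('n) (\<lambda>(k, l). w l $ e k)"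

text \<open>The cofactors along column \<open>k\<close> do not involve that column, so Laplace
  expansion displays the determinant as a linear function of the inserted vector
  \<open>x\<close>.\<close>

lemma det_tuple_upd_linear:
  fixes e :: "nat \<Rightarrow> 'n::finite"
  assumes "k < CARD('n)"
  shows "Determinant.det (tuple_mat e (w(k := x)))
    = (\<Sum>i<CARD('n). x $ e i * cofactor (tuple_mat e w) i k)"
proof -
  let ?s = "CARD('n)"
  have "Determinant.det (tuple_mat e (w(k := x)))
      = (\<Sum>i<?s. tuple_mat e (w(k := x)) $$ (i, k) * cofactor (tuple_mat e (w(k := x))) i k)"
    by (rule laplace_expansion_column[OF _ assms]) simp
  also have "\<dots> = (\<Sum>i<?s. x $ e i * cofactor (tuple_mat e w) i k)"
  proof (rule sum.cong)
    fix i assume "i \<in> {..<?s}"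
    have "mat_delete (tuple_mat e (w(k := x))) i k = mat_delete (tuple_mat e w) i k"
      by (rule eq_matI) (auto simp: mat_delete_def)
    then show "tuple_mat e (w(k := x)) $$ (i, k) * cofactor (tuple_mat e (w(k := x))) i k
        = x $ e i * cofactor (tuple_mat e w) i k"
      using \<open>i \<in> {..<?s}\<close> assms by (simp add: cofactor_def)
  qed simp
  finally show ?thesis .
qed

text \<open>Both sides are the determinant after left multiplication by the identity matrix with its last
  row replaced by \<open>d\<close>.\<close>

lemma det_tuple_dot:
  fixes e :: "nat \<Rightarrow> 'n::finite"
  assumes e: "bij_betw e {..<CARD('n)} UNIV" and m: "CARD('n) = Suc m"
  shows "int (d (e m)) * Determinant.det (tuple_mat e w)
    = Determinant.det (Matrix.mat (Suc m) (Suc m) (\<lambda>(k, l). if k = m then dot d (w l) else w l $ e k))"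
proof -
  define E :: "int mat" where
    "E = Matrix.mat (Suc m) (Suc m) (\<lambda>(k, l). if k = m then int (d (e l)) else if k = l then 1 else 0)"
  have E: "E \<in> carrier_mat (Suc m) (Suc m)" by (simp add: E_def)
  have "Determinant.det E = prod_list (diag_mat E)"
    by (rule det_lower_triangular[OF _ E]) (auto simp: E_def)
  also have "\<dots> = (\<Prod>i<Suc m. if i = m then int (d (e m)) else 1)"
    unfolding prod_list_diag_prod by (rule prod.cong) (auto simp: E_def)
  finally have det_E: "Determinant.det E = int (d (e m))" by simp
  have W: "tuple_mat e w \<in> carrier_mat (Suc m) (Suc m)" by (simp add: m)
  have dot: "dot d x = (\<Sum>i<Suc m. int (d (e i)) * x $ e i)" for x
    unfolding dot_def m[symmetric] by (rule sum.reindex_bij_betw[OF e, symmetric])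
  have "E * tuple_mat e w = Matrix.mat (Suc m) (Suc m) (\<lambda>(k, l). if k = m then dot d (w l) else w l $ e k)"
  proof (rule eq_matI)
    fix k l assume kl: "k < dim_row (Matrix.mat (Suc m) (Suc m) (\<lambda>(k, l). if k = m then dot d (w l) else w l $ e k))"
      "l < dim_col (Matrix.mat (Suc m) (Suc m) (\<lambda>(k, l). if k = m then dot d (w l) else w l $ e k))"
    then have kl: "k < Suc m" "l < Suc m" by auto
    have "(E * tuple_mat e w) $$ (k, l) = (\<Sum>i<Suc m. E $$ (k, i) * w l $ e i)"
      using kl E W by (simp add: scalar_prod_def m atLeast0LessThan del: sum.lessThan_Suc)
    also have "\<dots> = (if k = m then dot d (w l) else w l $ e k)"
    proof (cases "k = m")
      case True
      have "(\<Sum>i<Suc m. E $$ (k, i) * w l $ e i) = (\<Sum>i<Suc m. int (d (e i)) * w l $ e i)"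
        by (rule sum.cong) (auto simp: E_def True)
      then show ?thesis using True dot by simp
    next
      case False
      have "(\<Sum>i<Suc m. E $$ (k, i) * w l $ e i) = (\<Sum>i<Suc m. if i = k then w l $ e k else 0)"
        by (rule sum.cong) (use kl False in \<open>auto simp: E_def\<close>)
      then show ?thesis using kl False by simp
    qed
    finally show "(E * tuple_mat e w) $$ (k, l)
        = Matrix.mat (Suc m) (Suc m) (\<lambda>(k, l). if k = m then dot d (w l) else w l $ e k) $$ (k, l)"
      using kl by simp
  qed (use E W in auto)
  then show ?thesis using det_mult[OF E W] det_E by simp
qed

lemma int_subgroup_generator:
  fixes Z :: "int set"
  assumes diff: "\<And>x y. x \<in> Z \<Longrightarrow> y \<in> Z \<Longrightarrow> x - y \<in> Z" and "z \<in> Z" "z \<noteq> 0"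
  obtains h where "h > 0" "h \<in> Z" "\<And>x. x \<in> Z \<Longrightarrow> h dvd x"
proof -
  have zero: "0 \<in> Z" using diff[OF \<open>z \<in> Z\<close> \<open>z \<in> Z\<close>] by simp
  have neg: "- x \<in> Z" if "x \<in> Z" for x using diff[OF zero that] by simp
  have add: "x + y \<in> Z" if "x \<in> Z" "y \<in> Z" for x y using diff[OF that(1) neg[OF that(2)]] by simp
  have nat: "int n * x \<in> Z" if "x \<in> Z" for n x
    by (induction n) (auto simp: zero algebra_simps intro: add that)
  have mult: "k * x \<in> Z" if "x \<in> Z" for k x
    using nat[OF that, of "nat k"] nat[OF neg[OF that], of "nat (- k)"] by (cases "k \<ge> 0") auto
  define n where "n = (LEAST n. n > 0 \<and> int n \<in> Z)"
  have ex: "\<exists>n>0. int n \<in> Z"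
  proof (cases "z > 0")
    case True
    then show ?thesis using \<open>z \<in> Z\<close> by (intro exI[of _ "nat z"]) auto
  next
    case False
    then show ?thesis using neg[OF \<open>z \<in> Z\<close>] \<open>z \<noteq> 0\<close> by (intro exI[of _ "nat (- z)"]) auto
  qed
  then have n: "n > 0" "int n \<in> Z" using LeastI_ex[OF ex] unfolding n_def by auto
  have least: "n \<le> k" if "k > 0" "int k \<in> Z" for k
    unfolding n_def by (rule Least_le) (use that in blast)
  have "int n dvd x" if "x \<in> Z" for x
  proof -
    have "x mod int n = x - x div int n * int n" by (simp add: minus_div_mult_eq_mod)
    then have mem: "x mod int n \<in> Z" using diff[OF that mult[OF n(2)]] by simp
    have "x mod int n = 0"
    proof (rule ccontr)
      assume "x mod int n \<noteq> 0"
      moreover have "0 \<le> x mod int n" "x mod int n < int n" using n(1) by simp_all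
      ultimately have "0 < nat (x mod int n)" "int (nat (x mod int n)) \<in> Z" "nat (x mod int n) < n"
        using mem by auto
      then show False using least[of "nat (x mod int n)"] by linarith
    qed
    then show ?thesis by (simp add: dvd_eq_mod_eq_0)
  qed
  with n that[of "int n"] show ?thesis by simp
qed

section \<open>The completed lattice, its triangular basis and the minors\<close>

context no_face
begin

text \<open>All multiples of \<open>x\<close> have cosets in the finite set \<open>Tor\<close>, so
  two of them coincide.\<close>

lemma torsion_dot_kernel:
  assumes "dot d x = 0"
  obtains n :: nat where "n > 0" "int n *s x \<in> lat A"
proof -
  have "(\<lambda>n::nat. coset (int n *s x)) ` UNIV \<subseteq> Tor" using assms by (auto simp: Tor_def)
  then have "finite ((\<lambda>n::nat. coset (int n *s x)) ` UNIV)" using finite_Tor finite_subset by blast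
  then have "\<not> inj (\<lambda>n::nat. coset (int n *s x))" using finite_imageD infinite_UNIV_nat by blast
  then obtain a b :: nat where ab: "a < b" "coset (int b *s x) = coset (int a *s x)"
    unfolding inj_def by (metis linorder_neqE_nat)
  then have "int b *s x - int a *s x \<in> lat A" by (simp add: coset_eq_iff)
  moreover have "int b *s x - int a *s x = int (b - a) *s x"
    using ab(1) by (simp add: Finite_Cartesian_Product.vec_eq_iff of_nat_diff algebra_simps)
  ultimately show ?thesis using ab(1) by (intro that[of "b - a"]) auto
qed

text \<open>This is \<open>lat A + \<int> v\<close> when \<open>d \<cdot> v = 1\<close>.\<close>

definition Lam :: "int ^ 'n \<Rightarrow> (int ^ 'n) set" where
  "Lam v = {x. x - dot d x *s v \<in> lat A}"

lemma Lam_diff: "x \<in> Lam v \<Longrightarrow> y \<in> Lam v \<Longrightarrow> x - y \<in> Lam v"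
proof -
  assume "x \<in> Lam v" "y \<in> Lam v"
  then have "(x - dot d x *s v) - (y - dot d y *s v) \<in> lat A" by (auto simp: Lam_def intro: lat_diff)
  moreover have "(x - dot d x *s v) - (y - dot d y *s v) = (x - y) - dot d (x - y) *s v"
    by (simp add: Finite_Cartesian_Product.vec_eq_iff algebra_simps)
  ultimately show ?thesis by (simp add: Lam_def)
qed

lemma Lam_zero: "0 \<in> Lam v"
  by (simp add: Lam_def lat.zero)

lemma Lam_add: "x \<in> Lam v \<Longrightarrow> y \<in> Lam v \<Longrightarrow> x + y \<in> Lam v"
  using Lam_diff[of x v "0 - y"] Lam_diff[OF Lam_zero, of y v] by simp

lemma Lam_smult: "x \<in> Lam v \<Longrightarrow> k *s x \<in> Lam v"
proof -
  assume "x \<in> Lam v"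
  then have "k *s (x - dot d x *s v) \<in> lat A" by (auto simp: Lam_def intro: lat_smult)
  moreover have "k *s (x - dot d x *s v) = k *s x - dot d (k *s x) *s v"
    by (simp add: Finite_Cartesian_Product.vec_eq_iff algebra_simps)
  ultimately show ?thesis by (simp add: Lam_def)
qed

lemma lat_subset_Lam: "lat A \<subseteq> Lam v"
  by (auto simp: Lam_def dot_lat)

lemma self_in_Lam: "dot d v = 1 \<Longrightarrow> v \<in> Lam v"
  by (simp add: Lam_def lat.zero)

text \<open>A Hermite form of \<open>Lam v\<close>: \<open>h k\<close> is the positive generator of
  the k-th entries of those vectors that vanish in all later positions.\<close>

lemma triangular_basis:
  fixes e :: "nat \<Rightarrow> 'n"
  assumes e: "bij_betw e {..<CARD('n)} UNIV" and v: "dot d v = 1"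
  obtains U :: "nat \<Rightarrow> int ^ 'n" and h :: "nat \<Rightarrow> int" where
    "\<And>k. k < CARD('n) \<Longrightarrow> h k > 0" "\<And>k. k < CARD('n) \<Longrightarrow> U k \<in> Lam v"
    "\<And>k. k < CARD('n) \<Longrightarrow> U k $ e k = h k"
    "\<And>k i. k < i \<Longrightarrow> i < CARD('n) \<Longrightarrow> U k $ e i = 0"
    "\<And>k x. k < CARD('n) \<Longrightarrow> x \<in> Lam v \<Longrightarrow> (\<And>i. k < i \<Longrightarrow> i < CARD('n) \<Longrightarrow> x $ e i = 0) \<Longrightarrow> h k dvd x $ e k"
proof -
  define Y where "Y k = {x \<in> Lam v. \<forall>i. k < i \<and> i < CARD('n) \<longrightarrow> x $ e i = 0}" for k
  have "\<exists>u. u \<in> Y k \<and> u $ e k > 0 \<and> (\<forall>x\<in>Y k. u $ e k dvd x $ e k)" if k: "k < CARD('n)" for k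
  proof -
    \<comment> \<open>Full rank: this vector is orthogonal to \<open>d\<close>, hence torsion modulo
      the lattice, so a positive multiple of the unit vector lies in \<open>Lam v\<close> and the
      k-th entries are not all zero.\<close>
    let ?a = "axis (e k) 1 - int (d (e k)) *s v"
    have "dot d ?a = 0" using v by (simp add: dot_axis)
    then obtain n :: nat where n: "n > 0" "int n *s ?a \<in> lat A" by (rule torsion_dot_kernel)
    have "int n *s ?a = int n *s axis (e k) 1 - dot d (int n *s axis (e k) 1) *s v"
      by (simp add: dot_axis Finite_Cartesian_Product.vec_eq_iff algebra_simps)
    then have "int n *s axis (e k) 1 \<in> Lam v" using n(2) by (simp add: Lam_def)
    moreover have "(int n *s axis (e k) 1 :: int ^ 'n) $ e i = 0" if "k < i" "i < CARD('n)" for i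
    proof -
      have "e i \<noteq> e k" using that k inj_onD[OF bij_betw_imp_inj_on[OF e], of i k] by auto
      then show ?thesis by (simp add: axis_def)
    qed
    ultimately have mem: "int n *s axis (e k) 1 \<in> Y k" by (simp add: Y_def)
    have nz: "(int n *s axis (e k) 1 :: int ^ 'n) $ e k \<noteq> 0" using n(1) by (simp add: axis_def)
    obtain g where g: "g > 0" "g \<in> (\<lambda>x. x $ e k) ` Y k" "\<And>x. x \<in> (\<lambda>x. x $ e k) ` Y k \<Longrightarrow> g dvd x"
    proof (rule int_subgroup_generator[of "(\<lambda>x. x $ e k) ` Y k"])
      fix x y assume "x \<in> (\<lambda>x. x $ e k) ` Y k" "y \<in> (\<lambda>x. x $ e k) ` Y k"
      then obtain x' y' where "x' \<in> Y k" "y' \<in> Y k" "x = x' $ e k" "y = y' $ e k" by blast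
      moreover from this have "x' - y' \<in> Y k" by (auto simp: Y_def Lam_diff)
      ultimately show "x - y \<in> (\<lambda>x. x $ e k) ` Y k" by (metis imageI vector_minus_component)
    qed (use mem nz in blast)+
    then show ?thesis by auto
  qed
  then obtain U where U: "\<And>k. k < CARD('n) \<Longrightarrow> U k \<in> Y k"
    "\<And>k. k < CARD('n) \<Longrightarrow> U k $ e k > 0" "\<And>k x. k < CARD('n) \<Longrightarrow> x \<in> Y k \<Longrightarrow> U k $ e k dvd x $ e k"
    by metis
  show ?thesis
    by (rule that[of "\<lambda>k. U k $ e k" U]) (use U in \<open>auto simp: Y_def\<close>)
qed

text \<open>Division with remainder from the last position backwards; \<open>U k0\<close> vanishes
  after \<open>k0\<close>, so entries already reduced stay as they are.\<close>

lemma triangular_reduce: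
  fixes e :: "nat \<Rightarrow> 'n" and h :: "nat \<Rightarrow> int"
  assumes h: "\<And>k. k < CARD('n) \<Longrightarrow> h k > 0" and U: "\<And>k. k < CARD('n) \<Longrightarrow> U k \<in> Lam v"
    "\<And>k. k < CARD('n) \<Longrightarrow> U k $ e k = h k"
    "\<And>k i. k < i \<Longrightarrow> i < CARD('n) \<Longrightarrow> U k $ e i = 0"
  obtains y where "y \<in> Lam v" "\<And>k. k < CARD('n) \<Longrightarrow> (z - y) $ e k \<in> {0..<h k}"
proof -
  have "\<exists>y\<in>Lam v. \<forall>k. CARD('n) - j \<le> k \<and> k < CARD('n) \<longrightarrow> (z - y) $ e k \<in> {0..<h k}" if "j \<le> CARD('n)" for j
    using that
  proof (induction j)
    case 0
    then show ?case using Lam_zero[of v] by (intro bexI[of _ 0]) auto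
  next
    case (Suc j)
    then obtain y where y: "y \<in> Lam v" "\<And>k. CARD('n) - j \<le> k \<Longrightarrow> k < CARD('n) \<Longrightarrow> (z - y) $ e k \<in> {0..<h k}"
      by auto
    define k0 where "k0 = CARD('n) - Suc j"
    have k0: "k0 < CARD('n)" using Suc.prems by (simp add: k0_def)
    define q where "q = (z - y) $ e k0 div h k0"
    have "y + q *s U k0 \<in> Lam v" by (intro Lam_add Lam_smult y(1) U(1) k0)
    moreover have "(z - (y + q *s U k0)) $ e k \<in> {0..<h k}" if k: "CARD('n) - Suc j \<le> k" "k < CARD('n)" for k
    proof (cases "k = k0")
      case True
      have "(z - (y + q *s U k0)) $ e k = (z - y) $ e k0 - q * h k0"
        using U(2)[OF k0] by (simp add: True)
      also have "\<dots> = (z - y) $ e k0 mod h k0" unfolding q_def by (rule minus_div_mult_eq_mod)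
      finally show ?thesis using h[OF k0] by (simp add: True)
    next
      case False
      then have "k0 < k" using k(1) by (simp add: k0_def)
      then have eq: "(z - (y + q *s U k0)) $ e k = (z - y) $ e k" using U(3)[OF _ k(2)] by simp
      show ?thesis unfolding eq by (rule y(2)) (use False k in \<open>simp_all add: k0_def\<close>)
    qed
    ultimately show ?case by blast
  qed
  from this[of "CARD('n)"] that show ?thesis by auto
qed

text \<open>The last nonzero entry is divisible by the corresponding \<open>h j\<close>, so a
  multiple of \<open>U j\<close> removes it.\<close>

lemma triangular_generates:
  fixes e :: "nat \<Rightarrow> 'n" and h :: "nat \<Rightarrow> int"
  assumes e: "bij_betw e {..<CARD('n)} UNIV"
    and h: "\<And>k. k < CARD('n) \<Longrightarrow> h k > 0" and U: "\<And>k. k < CARD('n) \<Longrightarrow> U k \<in> Lam v"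
    "\<And>k. k < CARD('n) \<Longrightarrow> U k $ e k = h k"
    "\<And>k i. k < i \<Longrightarrow> i < CARD('n) \<Longrightarrow> U k $ e i = 0"
    and dvd: "\<And>k x. k < CARD('n) \<Longrightarrow> x \<in> Lam v \<Longrightarrow> (\<And>i. k < i \<Longrightarrow> i < CARD('n) \<Longrightarrow> x $ e i = 0) \<Longrightarrow> h k dvd x $ e k"
    and x: "x \<in> Lam v"
  obtains c where "x = (\<Sum>l<CARD('n). c l *s U l)"
proof -
  have "\<exists>c. x = (\<Sum>l<j. c l *s U l)" if "j \<le> CARD('n)" "x \<in> Lam v" "\<And>i. j \<le> i \<Longrightarrow> i < CARD('n) \<Longrightarrow> x $ e i = 0" for j x
    using that
  proof (induction j arbitrary: x)
    case 0
    have "x $ i = 0" for i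
      using 0(3) e by (metis UNIV_I bij_betw_def imageE le0 lessThan_iff)
    then show ?case by (simp add: Finite_Cartesian_Product.vec_eq_iff)
  next
    case (Suc j)
    have "h j dvd x $ e j" using Suc.prems by (intro dvd) auto
    then obtain q where q: "x $ e j = h j * q" by blast
    have "x - q *s U j \<in> Lam v" using Suc.prems by (intro Lam_diff Lam_smult U(1)) auto
    moreover have "(x - q *s U j) $ e i = 0" if "j \<le> i" "i < CARD('n)" for i
    proof (cases "i = j")
      case True
      then show ?thesis using q U(2)[of j] Suc.prems by simp
    next
      case False
      then show ?thesis using that Suc.prems(3)[of i] U(3)[of j i] by simp
    qed
    ultimately obtain c where c: "x - q *s U j = (\<Sum>l<j. c l *s U l)"
      using Suc.IH[of "x - q *s U j"] Suc.prems by auto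
    have "x = (\<Sum>l<Suc j. (c(j := q)) l *s U l)"
    proof -
      have "(\<Sum>l<j. (c(j := q)) l *s U l) = (\<Sum>l<j. c l *s U l)" by (rule sum.cong) auto
      then show ?thesis using c by (simp add: algebra_simps)
    qed
    then show ?case by blast
  qed
  from this[of "CARD('n)" x] x that show ?thesis by auto
qed

text \<open>The box with sides \<open>h k\<close> represents the integer vectors modulo
  \<open>Lam v\<close>, and subtracting \<open>dot d x *s v\<close> identifies that quotient with
  \<open>Tor\<close>.\<close>

lemma card_Tor_eq_prod:
  fixes e :: "nat \<Rightarrow> 'n" and h :: "nat \<Rightarrow> int"
  assumes e: "bij_betw e {..<CARD('n)} UNIV" and v: "dot d v = 1"
    and h: "\<And>k. k < CARD('n) \<Longrightarrow> h k > 0" and U: "\<And>k. k < CARD('n) \<Longrightarrow> U k \<in> Lam v"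
    "\<And>k. k < CARD('n) \<Longrightarrow> U k $ e k = h k"
    "\<And>k i. k < i \<Longrightarrow> i < CARD('n) \<Longrightarrow> U k $ e i = 0"
    and dvd: "\<And>k x. k < CARD('n) \<Longrightarrow> x \<in> Lam v \<Longrightarrow> (\<And>i. k < i \<Longrightarrow> i < CARD('n) \<Longrightarrow> x $ e i = 0) \<Longrightarrow> h k dvd x $ e k"
  shows "int (card Tor) = (\<Prod>k<CARD('n). h k)"
proof -
  have surj: "\<exists>k<CARD('n). e k = i" for i
  proof -
    have "i \<in> e ` {..<CARD('n)}" using bij_betw_imp_surj_on[OF e] by simp
    then show ?thesis by auto
  qed
  define B :: "(int ^ 'n) set" where "B = {x. \<forall>k<CARD('n). x $ e k \<in> {0..<h k}}"
  define H where "H i = h (inv_into {..<CARD('n)} e i)" for i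
  have H: "H (e k) = h k" if "k < CARD('n)" for k
    using that bij_betw_imp_inj_on[OF e] by (simp add: H_def)
  have "bij_betw Finite_Cartesian_Product.vec_nth B (PiE UNIV (\<lambda>i. {0..<H i}))"
  proof (rule bij_betw_byWitness[where f' = vec_lambda])
    have "x $ i \<in> {0..<H i}" if "x \<in> B" for x i
    proof -
      obtain k where "k < CARD('n)" "e k = i" using surj by blast
      then show ?thesis using that H by (auto simp: B_def)
    qed
    then show "Finite_Cartesian_Product.vec_nth ` B \<subseteq> PiE UNIV (\<lambda>i. {0..<H i})" by auto
    show "vec_lambda ` PiE UNIV (\<lambda>i. {0..<H i}) \<subseteq> B"
    proof
      fix x assume "x \<in> vec_lambda ` PiE UNIV (\<lambda>i. {0..<H i})"
      then obtain f where f: "f \<in> PiE UNIV (\<lambda>i. {0..<H i})" and x: "x = vec_lambda f" by (rule imageE)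
      show "x \<in> B" unfolding B_def
      proof (intro CollectI allI impI)
        fix k assume "k < CARD('n)"
        then show "x $ e k \<in> {0..<h k}" using PiE_mem[OF f, of "e k"] H by (simp add: x)
      qed
    qed
  qed (auto simp: vec_lambda_inverse vec_nth_inverse)
  then have "card B = (\<Prod>i\<in>UNIV. card {0..<H i})"
    using bij_betw_same_card card_PiE[of UNIV "\<lambda>i. {0..<H i}"] by fastforce
  also have "\<dots> = (\<Prod>k<CARD('n). card {0..<H (e k)})"
    by (rule prod.reindex_bij_betw[OF e, symmetric])
  finally have "int (card B) = (\<Prod>k<CARD('n). int (card {0..<H (e k)}))" by simp
  also have "\<dots> = (\<Prod>k<CARD('n). h k)" by (rule prod.cong) (auto simp: H less_imp_le h)
  finally have card_B: "int (card B) = (\<Prod>k<CARD('n). h k)" .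
  have Lam_iff: "coset (x - dot d x *s v) = coset (y - dot d y *s v) \<longleftrightarrow> x - y \<in> Lam v" for x y
  proof -
    have "(x - dot d x *s v) - (y - dot d y *s v) = (x - y) - dot d (x - y) *s v"
      by (simp add: Finite_Cartesian_Product.vec_eq_iff algebra_simps)
    then show ?thesis by (simp only: coset_eq_iff Lam_def mem_Collect_eq)
  qed
  have "bij_betw (\<lambda>x. coset (x - dot d x *s v)) B Tor"
    unfolding bij_betw_def
  proof
    show "inj_on (\<lambda>x. coset (x - dot d x *s v)) B"
    proof (rule inj_onI, rule ccontr)
      fix x y assume xy: "x \<in> B" "y \<in> B" "coset (x - dot d x *s v) = coset (y - dot d y *s v)" "x \<noteq> y"
      \<comment> \<open>At the last position where \<open>x\<close> and \<open>y\<close> differ, the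
        difference is a nonzero multiple of \<open>h\<close>, yet both entries lie in an interval of
        length \<open>h\<close>.\<close>
      define Z where "Z = {k. k < CARD('n) \<and> x $ e k \<noteq> y $ e k}"
      have "Z \<noteq> {}"
      proof
        assume Z: "Z = {}"
        have "x $ i = y $ i" for i
        proof -
          obtain k where "k < CARD('n)" "e k = i" using surj by blast
          then show ?thesis using Z by (auto simp: Z_def)
        qed
        then show False using xy(4) by (simp add: Finite_Cartesian_Product.vec_eq_iff)
      qed
      moreover have "finite Z" by (simp add: Z_def)
      ultimately have Max: "Max Z \<in> Z" "\<And>i. i \<in> Z \<Longrightarrow> i \<le> Max Z" by auto
      let ?k = "Max Z"
      have k: "?k < CARD('n)" "x $ e ?k \<noteq> y $ e ?k" using Max(1) by (auto simp: Z_def)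
      have "h ?k dvd (x - y) $ e ?k"
      proof (rule dvd[OF k(1)])
        show "x - y \<in> Lam v" using xy(3) Lam_iff by blast
        fix i assume "?k < i" "i < CARD('n)"
        then have "i \<notin> Z" using Max(2)[of i] by auto
        then show "(x - y) $ e i = 0" using \<open>i < CARD('n)\<close> by (simp add: Z_def)
      qed
      then have "h ?k \<le> \<bar>x $ e ?k - y $ e ?k\<bar>" using k(2) dvd_imp_le_int[of "x $ e ?k - y $ e ?k" "h ?k"] by simp
      moreover have "x $ e ?k \<in> {0..<h ?k}" "y $ e ?k \<in> {0..<h ?k}" using xy(1,2) k(1) by (auto simp: B_def)
      ultimately show False by auto
    qed
    show "(\<lambda>x. coset (x - dot d x *s v)) ` B = Tor"
    proof
      show "(\<lambda>x. coset (x - dot d x *s v)) ` B \<subseteq> Tor" using v by (auto simp: Tor_def)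
      show "Tor \<subseteq> (\<lambda>x. coset (x - dot d x *s v)) ` B"
      proof
        fix C assume "C \<in> Tor"
        then obtain z where z: "dot d z = 0" "C = coset z" by (auto simp: Tor_def)
        obtain y where y: "y \<in> Lam v" "\<And>k. k < CARD('n) \<Longrightarrow> (z - y) $ e k \<in> {0..<h k}"
          using triangular_reduce[of h U v e z] h U by blast
        have "z - (z - y) \<in> Lam v" using y(1) by simp
        then have "coset (z - dot d z *s v) = coset ((z - y) - dot d (z - y) *s v)"
          by (simp only: Lam_iff)
        moreover have "z - dot d z *s v = z" by (simp add: z Finite_Cartesian_Product.vec_eq_iff)
        ultimately have "C = coset ((z - y) - dot d (z - y) *s v)" by (simp only: z(2))
        moreover have "z - y \<in> B" unfolding B_def using y(2) by blast
        ultimately show "C \<in> (\<lambda>x. coset (x - dot d x *s v)) ` B" by (rule image_eqI)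
      qed
    qed
  qed
  then show ?thesis using card_B bij_betw_same_card by fastforce
qed

text \<open>The triangular basis has the product of the \<open>h k\<close> as its determinant, and
  any other tuple is this basis times an integer matrix.\<close>

lemma det_Lam_tuples:
  fixes e :: "nat \<Rightarrow> 'n"
  assumes e: "bij_betw e {..<CARD('n)} UNIV" and v: "dot d v = 1"
  obtains U where "\<And>l. l < CARD('n) \<Longrightarrow> U l \<in> Lam v"
    "Determinant.det (tuple_mat e U) = int (card Tor)"
    "\<And>w. (\<And>l. l < CARD('n) \<Longrightarrow> w l \<in> Lam v) \<Longrightarrow> int (card Tor) dvd Determinant.det (tuple_mat e w)"
proof (rule triangular_basis[OF e v])
  let ?s = "CARD('n)"
  fix U and h :: "nat \<Rightarrow> int"
  assume h: "\<And>k. k < ?s \<Longrightarrow> h k > 0" and U: "\<And>k. k < ?s \<Longrightarrow> U k \<in> Lam v"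
    "\<And>k. k < ?s \<Longrightarrow> U k $ e k = h k"
    "\<And>k i. k < i \<Longrightarrow> i < ?s \<Longrightarrow> U k $ e i = 0"
    and dvd: "\<And>k x. k < ?s \<Longrightarrow> x \<in> Lam v \<Longrightarrow> (\<And>i. k < i \<Longrightarrow> i < ?s \<Longrightarrow> x $ e i = 0) \<Longrightarrow> h k dvd x $ e k"
  have car: "tuple_mat e w \<in> carrier_mat ?s ?s" for w by simp
  have "Determinant.det (tuple_mat e U) = prod_list (diag_mat (tuple_mat e U))"
    by (rule det_upper_triangular[OF _ car]) (auto simp: U(3))
  also have "\<dots> = (\<Prod>k<?s. h k)"
    unfolding prod_list_diag_prod by (rule prod.cong) (auto simp: U(2))
  also have "\<dots> = int (card Tor)"
    by (rule card_Tor_eq_prod[OF e v, symmetric]) (fact h U dvd)+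
  finally have det_U: "Determinant.det (tuple_mat e U) = int (card Tor)" .
  have dvd_det: "int (card Tor) dvd Determinant.det (tuple_mat e w)" if w: "\<And>l. l < ?s \<Longrightarrow> w l \<in> Lam v" for w
  proof -
    have "\<exists>c. w l = (\<Sum>i<?s. c i *s U i)" if "l < ?s" for l
      by (rule triangular_generates[OF e _ _ _ _ _ w[OF that]]) (fact h U dvd | blast)+
    then obtain c where c: "\<And>l. l < ?s \<Longrightarrow> w l = (\<Sum>i<?s. c l i *s U i)" by metis
    let ?C = "Matrix.mat ?s ?s (\<lambda>(i, l). c l i)"
    have "tuple_mat e w = tuple_mat e U * ?C"
    proof (rule eq_matI)
      fix k l assume "k < dim_row (tuple_mat e U * ?C)" "l < dim_col (tuple_mat e U * ?C)"
      then have kl: "k < ?s" "l < ?s" by auto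
      have "w l $ e k = (\<Sum>i<?s. c l i * U i $ e k)" unfolding c[OF kl(2)] by simp
      then show "tuple_mat e w $$ (k, l) = (tuple_mat e U * ?C) $$ (k, l)"
        using kl by (simp add: scalar_prod_def atLeast0LessThan mult.commute)
    qed auto
    then have "Determinant.det (tuple_mat e w) = Determinant.det (tuple_mat e U) * Determinant.det ?C"
      using det_mult[OF car, of ?C] by simp
    then show ?thesis by (simp add: det_U)
  qed
  show thesis by (rule that[of U]) (fact U(1) det_U dvd_det)+
qed

text \<open>Two divisibilities: each minor is an entry of \<open>d\<close> times the determinant of
  a tuple in \<open>Lam v\<close>, and the gcd \<open>g\<close> of the minors divides the
  determinants of all such tuples, in particular of the triangular basis.\<close>

lemma card_Tor_eq_Delta:
  fixes L :: "int ^ 'm ^ 'n"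
  assumes A: "A = columns L"
  shows "int (card Tor) = Delta (CARD('n) - 1) L"
proof -
  obtain v where v: "dot d v = 1" by (rule bezout_d)
  obtain m where m: "CARD('n) = Suc m" by (metis not0_implies_Suc zero_less_card_finite less_irrefl)
  have column_A: "column c L \<in> A" for c unfolding A columns_def by blast
  have column_dot: "dot d (column c L) = 0" for c by (rule dot_gen[OF column_A])
  have column_Lam: "column c L \<in> Lam v" for c using lat.gen[OF column_A] lat_subset_Lam by blast
  define g where "g = Delta m L"
  have Tor_dvd: "int (card Tor) dvd x" if x_minor: "x \<in> minors m L" for x
  proof -
    obtain r c where x: "x = Determinant.det (Matrix.mat m m (\<lambda>(k, l). L $ r k $ c l))" and r: "inj_on r {..<m}"
      using x_minor unfolding minors_def by blast
    have "card (r ` {..<m}) = m" using r by (simp add: card_image)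
    then have "r ` {..<m} \<noteq> UNIV" using m by auto
    then obtain i where i: "i \<notin> r ` {..<m}" by blast
    \<comment> \<open>The omitted row is put last and \<open>v\<close> becomes the last column. The
      other columns being orthogonal to \<open>d\<close>, the matrix in \<open>det_tuple_dot\<close>
      has last row 0, ..., 0, 1, and its determinant is the given minor.\<close>
    define e where "e = r(m := i)"
    have inj: "inj_on e {..<CARD('n)}"
      unfolding m lessThan_Suc e_def using r i by (auto simp: inj_on_def)
    have "e ` {..<CARD('n)} = UNIV"
      using inj by (intro card_subset_eq) (auto simp: card_image)
    with inj have e: "bij_betw e {..<CARD('n)} UNIV" by (simp add: bij_betw_def)
    define w where "w l = (if l < m then column (c l) L else v)" for l
    let ?M = "Matrix.mat (Suc m) (Suc m) (\<lambda>(k, l). if k = m then dot d (w l) else w l $ e k)"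
    have M: "?M \<in> carrier_mat (Suc m) (Suc m)" by simp
    have "Determinant.det ?M = (\<Sum>j<Suc m. ?M $$ (m, j) * cofactor ?M m j)"
      by (rule laplace_expansion_row[OF M]) simp
    also have "\<dots> = (\<Sum>j<Suc m. if j = m then cofactor ?M m m else 0)"
      by (rule sum.cong) (auto simp: w_def column_dot v)
    also have "\<dots> = Determinant.det (mat_delete ?M m m)" by (simp add: cofactor_def)
    also have "mat_delete ?M m m = Matrix.mat m m (\<lambda>(k, l). L $ r k $ c l)"
      by (rule eq_matI) (auto simp: mat_delete_def w_def e_def column_def)
    finally have "x = int (d (e m)) * Determinant.det (tuple_mat e w)"
      unfolding det_tuple_dot[OF e m] x by simp
    moreover have "w l \<in> Lam v" for l
      using column_Lam self_in_Lam[OF v] by (simp add: w_def)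
    then have "int (card Tor) dvd Determinant.det (tuple_mat e w)"
      using det_Lam_tuples[OF e v] by metis
    ultimately show ?thesis by simp
  qed
  have g_dvd: "g dvd x" if "x \<in> minors m L" for x
    using that unfolding g_def Delta_def by (cases "x = 0") (auto intro: Gcd_dvd)
  have g_nonneg: "g \<ge> 0" unfolding g_def Delta_def by simp
  obtain e :: "nat \<Rightarrow> 'n" where e: "bij_betw e {..<CARD('n)} UNIV"
    using ex_bij_betw_nat_finite[OF finite[of "UNIV :: 'n set"]] by (auto simp: atLeast0LessThan)
  \<comment> \<open>If \<open>v\<close> occurs once among distinct vectors, expansion along it has
    signed minors as cofactors. A repeated vector gives determinant zero, and so does a tuple
    without \<open>v\<close>, all of whose members are orthogonal to \<open>d\<close>.\<close>
  have g_dvd_generators: "g dvd Determinant.det (tuple_mat e w)"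
    if w: "\<And>l. l < CARD('n) \<Longrightarrow> w l \<in> insert v A" for w
  proof (cases "inj_on w {..<CARD('n)} \<and> (\<exists>k<CARD('n). w k = v)")
    case True
    then obtain k where k: "k < CARD('n)" "w k = v" and inj: "inj_on w {..<CARD('n)}" by blast
    have "g dvd cofactor (tuple_mat e w) i k" if i: "i < CARD('n)" for i
    proof -
      \<comment> \<open>The renumbering that skips index \<open>a\<close>, as in
        \<open>mat_delete\<close>.\<close>
      define sk where "sk a b = (if b < a then b else Suc b)" for a b :: nat
      have sk: "sk a b < CARD('n)" "sk a b \<noteq> a" if "b < m" for a b using that m by (auto simp: sk_def)
      have sk_inj: "inj_on (sk a) {..<m}" for a by (auto simp: inj_on_def sk_def split: if_splits)
      have "\<exists>c. w (sk k b) = column c L" if "b < m" for b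
      proof -
        have "w (sk k b) \<noteq> v" using inj_onD[OF inj, of "sk k b" k] sk[OF that] k by auto
        then show ?thesis using w[OF sk(1)[OF that]] A unfolding columns_def by auto
      qed
      then obtain c where c: "\<And>b. b < m \<Longrightarrow> w (sk k b) = column (c b) L" by metis
      have inj_c: "inj_on c {..<m}"
      proof (rule inj_onI)
        fix a b assume ab: "a \<in> {..<m}" "b \<in> {..<m}" "c a = c b"
        then have "w (sk k a) = w (sk k b)" using c by simp
        then have "sk k a = sk k b" using inj_onD[OF inj] sk(1) ab by auto
        then show "a = b" using inj_onD[OF sk_inj] ab by auto
      qed
      have inj_r: "inj_on (e \<circ> sk i) {..<m}"
        by (rule comp_inj_on[OF sk_inj inj_on_subset[OF bij_betw_imp_inj_on[OF e]]]) (use sk in auto)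
      have md: "mat_delete (tuple_mat e w) i k = Matrix.mat m m (\<lambda>(a, b). L $ (e \<circ> sk i) a $ c b)"
      proof (rule eq_matI)
        fix a b assume "a < dim_row (Matrix.mat m m (\<lambda>(a, b). L $ (e \<circ> sk i) a $ c b))"
          "b < dim_col (Matrix.mat m m (\<lambda>(a, b). L $ (e \<circ> sk i) a $ c b))"
        then have ab: "a < m" "b < m" by auto
        have "mat_delete (tuple_mat e w) i k $$ (a, b) = w (sk k b) $ e (sk i a)"
          using ab m by (auto simp: mat_delete_def sk_def)
        then show "mat_delete (tuple_mat e w) i k $$ (a, b) = Matrix.mat m m (\<lambda>(a, b). L $ (e \<circ> sk i) a $ c b) $$ (a, b)"
          using ab c[OF ab(2)] by (simp add: column_def)
      qed (auto simp: mat_delete_def m)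
      have "Determinant.det (mat_delete (tuple_mat e w) i k) \<in> minors m L"
        unfolding minors_def md by (intro CollectI exI conjI) (rule HOL.refl inj_r inj_c)+
      then show ?thesis unfolding cofactor_def by (intro dvd_mult g_dvd)
    qed
    then have "g dvd Determinant.det (tuple_mat e (w(k := w k)))"
      unfolding det_tuple_upd_linear[OF k(1)] by (intro dvd_sum dvd_mult) auto
    then show ?thesis by simp
  next
    case False
    have "Determinant.det (tuple_mat e w) = 0"
    proof (cases "inj_on w {..<CARD('n)}")
      case True
      then have "w l \<in> A" if "l < CARD('n)" for l using False w[OF that] that by auto
      then have dot0: "dot d (w l) = 0" if "l < CARD('n)" for l using that by (simp add: dot_gen)
      let ?M = "Matrix.mat (Suc m) (Suc m) (\<lambda>(k, l). if k = m then dot d (w l) else w l $ e k)"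
      have M: "?M \<in> carrier_mat (Suc m) (Suc m)" by simp
      have "Determinant.det ?M = (\<Sum>j<Suc m. ?M $$ (m, j) * cofactor ?M m j)"
        by (rule laplace_expansion_row[OF M]) simp
      also have "\<dots> = 0" by (rule sum.neutral) (auto simp: dot0 m)
      finally have "int (d (e m)) * Determinant.det (tuple_mat e w) = 0"
        unfolding det_tuple_dot[OF e m] .
      then show ?thesis using d_pos[of "e m"] by simp
    next
      case False
      then obtain a b where ab: "a < CARD('n)" "b < CARD('n)" "a \<noteq> b" "w a = w b"
        unfolding inj_on_def by auto
      show ?thesis
        by (rule det_identical_columns[of _ "CARD('n)" a b]) (use ab in \<open>auto simp: vec_eq_iff\<close>)
    qed
    then show ?thesis by simp
  qed
  have g_dvd_Lam: "g dvd Determinant.det (tuple_mat e w)"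
    if "\<And>l. l < CARD('n) \<Longrightarrow> w l \<in> Lam v" for w
  proof -
    \<comment> \<open>Positions below \<open>j\<close> may hold any vector of \<open>Lam v\<close>,
      the others only \<open>v\<close> or columns of L; each induction step frees one more
      position.\<close>
    have "g dvd Determinant.det (tuple_mat e w)"
      if "j \<le> CARD('n)" "\<And>l. l < j \<Longrightarrow> w l \<in> Lam v"
        "\<And>l. j \<le> l \<Longrightarrow> l < CARD('n) \<Longrightarrow> w l \<in> insert v A" for j w
      using that
    proof (induction j arbitrary: w)
      case 0
      then show ?case by (intro g_dvd_generators) auto
    next
      case (Suc j)
      have j: "j < CARD('n)" using Suc.prems(1) by simp
      \<comment> \<open>The determinant as a linear function of column \<open>j\<close>, along which
        divisibility passes from the generators to \<open>lat A\<close> and then to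
        \<open>Lam v\<close>.\<close>
      let ?cf = "\<lambda>x. \<Sum>i<CARD('n). x $ e i * cofactor (tuple_mat e w) i j"
      have gen: "g dvd ?cf x" if "x \<in> insert v A" for x
        unfolding det_tuple_upd_linear[OF j, symmetric]
        by (rule Suc.IH) (use Suc.prems that in auto)
      have add: "?cf (x + y) = ?cf x + ?cf y" for x y by (simp add: sum.distrib algebra_simps)
      have scale: "?cf (a *s x) = a * ?cf x" for a x by (simp add: sum_distrib_left algebra_simps)
      have lat: "g dvd ?cf x" if "x \<in> lat A" for x using that
      proof (induction rule: lat.induct)
        case zero
        then show ?case by simp
      next
        case (gen a)
        then show ?case by (intro \<open>\<And>x. x \<in> insert v A \<Longrightarrow> g dvd ?cf x\<close>) simp
      next
        case (uminus x)
        then show ?case by (simp add: sum_negf)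
      next
        case (add x y)
        show ?case unfolding \<open>\<And>x y. ?cf (x + y) = ?cf x + ?cf y\<close> by (intro dvd_add add.IH)
      qed
      let ?x = "w j"
      have "?x - dot d ?x *s v \<in> lat A" using Suc.prems(2)[of j] by (simp add: Lam_def)
      from lat[OF this] have "g dvd ?cf (?x - dot d ?x *s v) + dot d ?x * ?cf v"
        by (rule dvd_add) (use gen[of v] in simp)
      then have "g dvd ?cf ((?x - dot d ?x *s v) + dot d ?x *s v)" unfolding add scale .
      then have "g dvd ?cf ?x" by simp
      then have "g dvd Determinant.det (tuple_mat e (w(j := w j)))"
        unfolding det_tuple_upd_linear[OF j] .
      then show ?case by simp
    qed
    from this[of "CARD('n)" w] that show ?thesis by auto
  qed
  have "g dvd int (card Tor)"
    by (rule det_Lam_tuples[OF e v]) (use g_dvd_Lam in metis)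
  moreover have "int (card Tor) dvd g"
    unfolding g_def Delta_def by (rule Gcd_greatest) (use Tor_dvd in blast)
  ultimately have "int (card Tor) = g" 
    by (intro zdvd_antisym_nonneg g_nonneg) simp
  then show ?thesis by (simp add: g_def m)
qed

end

subsection \<open>Evaluation\<close>

lemma eval_mv_plift: "eval_mv x = plift (\<lambda>c a. a * (\<Prod>i\<in>UNIV. (x $ i) ^ Poly_Mapping.lookup c i))"
  by (rule ext) (simp add: eval_mv_def plift_def)

lemma eval_mv_add: "eval_mv x (p + q) = eval_mv x p + eval_mv x q"
  unfolding eval_mv_plift by (rule plift_add) (auto simp: algebra_simps)

lemma eval_mv_mult: "eval_mv x (p * q) = eval_mv x p * eval_mv x q"
  unfolding eval_mv_plift
  by (rule plift_mult) (auto simp: algebra_simps lookup_add power_add prod.distrib)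

lemma eval_mv_diff: "eval_mv x (p - q) = eval_mv x p - eval_mv x q"
  using eval_mv_add[of x "p - q" q] by simp

lemma eval_mv_monom: "eval_mv x (monom_t c) = (\<Prod>i\<in>UNIV. (x $ i) ^ Poly_Mapping.lookup c i)"
  unfolding eval_mv_plift monom_t_def by (subst plift_single) auto

lemma zero_set_Idl: "zero_set (Idl\<^bsub>class_ring\<^esub> G) = zero_set G"
proof
  show "zero_set (Idl\<^bsub>class_ring\<^esub> G) \<subseteq> zero_set G"
    using Idl_superset[of G] by (auto simp: zero_set_def)
  show "zero_set G \<subseteq> zero_set (Idl\<^bsub>class_ring\<^esub> G)"
  proof
    fix x assume "x \<in> zero_set G"
    then have "G \<subseteq> {p. eval_mv x p = 0}" by (auto simp: zero_set_def)
    then have "Idl\<^bsub>class_ring\<^esub> G \<subseteq> {p. eval_mv x p = 0}"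
      by (intro Idl_minimal ideal_kernel eval_mv_add eval_mv_mult)
    then show "x \<in> zero_set (Idl\<^bsub>class_ring\<^esub> G)" by (auto simp: zero_set_def)
  qed
qed

section \<open>From the hypotheses on the ideal to \<open>no_face\<close>\<close>

lemma matrix_ideal_eq: "matrix_ideal L = binomial_ideal (columns L)"
  by (simp add: matrix_ideal_def binomial_ideal_def)

lemma hom_component_binomial:
  assumes "weight d b \<noteq> weight d c"
  shows "hom_component d (weight d b) (monom_t b - monom_t c :: ('n::finite, 'k::field) mvpoly) = monom_t b"
proof -
  have "b \<noteq> c" using assms by blast
  then have "{x \<in> Poly_Mapping.keys (monom_t b - monom_t c :: ('n, 'k) mvpoly). weight d x = weight d b} = {b}"
    using assms by (auto simp: in_keys_iff lookup_minus monom_t_def lookup_single when_def split: if_splits)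
  then show ?thesis using \<open>b \<noteq> c\<close>
    by (simp add: hom_component_def lookup_minus monom_t_def lookup_single)
qed

text \<open>If the two monomials of a generator had different weights, homogeneity would put one of
  them into the ideal. But the ideal vanishes at the point with all entries 1, where a monomial has
  value 1.\<close>

lemma homogeneous_imp_orthogonal:
  assumes hom: "homogeneous_ideal d (binomial_ideal A :: ('n::finite, 'k::field) mvpoly set)" and a: "a \<in> A"
  shows "dot d a = 0"
proof (rule ccontr)
  let ?I = "binomial_ideal A :: ('n, 'k) mvpoly set"
  assume "dot d a \<noteq> 0"
  then have w: "weight d (pos_part a) \<noteq> weight d (neg_part a)"
    using arg_cong[OF ivec_parts[of a], of "dot d"] by auto
  have "monom_t (pos_part a) - monom_t (neg_part a) \<in> ?I"
    using mcong_imp_binomial_ideal[OF mcong.gen[OF a, of 0]] by simp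
  then have "hom_component d (weight d (pos_part a)) (monom_t (pos_part a) - monom_t (neg_part a)) \<in> ?I"
    using hom by (auto simp: homogeneous_ideal_def)
  then have "monom_t (pos_part a) \<in> ?I" unfolding hom_component_binomial[OF w] .
  moreover have "(\<chi> i. 1) \<in> zero_set ?I"
    unfolding binomial_ideal_def zero_set_Idl
    by (auto simp: zero_set_def eval_mv_diff eval_mv_monom)
  ultimately have "eval_mv (\<chi> i. 1) (monom_t (pos_part a) :: ('n, 'k) mvpoly) = 0"
    by (simp add: zero_set_def)
  then show False by (simp add: eval_mv_monom)
qed

text \<open>At the indicator of \<open>F\<close> a monomial is 1 if its support lies in
  \<open>F\<close> and 0 otherwise, so the two terms of each generator agree.\<close>

lemma indicator_in_zero_set:
  assumes "\<And>a. a \<in> A \<Longrightarrow> {i. a $ i > 0} \<subseteq> F \<longleftrightarrow> {i. a $ i < 0} \<subseteq> F"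
  shows "(\<chi> i. if i \<in> F then 1 else 0) \<in> zero_set (binomial_ideal A :: ('n::finite, 'k::field) mvpoly set)"
proof -
  have monom: "eval_mv (\<chi> i. if i \<in> F then 1 else 0) (monom_t c :: ('n, 'k) mvpoly)
      = (if {i. Poly_Mapping.lookup c i > 0} \<subseteq> F then 1 else 0)" for c
  proof (cases "{i. Poly_Mapping.lookup c i > 0} \<subseteq> F")
    case True
    then have "Poly_Mapping.lookup c i = 0" if "i \<notin> F" for i using that by auto
    with True show ?thesis unfolding eval_mv_monom by (auto intro!: prod.neutral)
  next
    case False
    then obtain i where "i \<notin> F" "Poly_Mapping.lookup c i > 0" by blast
    then have "(\<Prod>i\<in>UNIV. (\<chi> i. (if i \<in> F then 1 else 0 :: 'k)) $ i ^ Poly_Mapping.lookup c i) = 0"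
      by (intro prod_zero bexI[of _ i]) auto
    then show ?thesis using False unfolding eval_mv_monom by simp
  qed
  show ?thesis
    unfolding binomial_ideal_def zero_set_Idl using assms
    by (auto simp: zero_set_def eval_mv_diff monom)
qed

subsection \<open>The torsion subgroup\<close>

lemma Zn_group_simps [simp]:
  "carrier Zn_group = UNIV" "x \<otimes>\<^bsub>Zn_group\<^esub> y = x + y" "\<one>\<^bsub>Zn_group\<^esub> = 0"
  by (simp_all add: Zn_group_def)

lemma Zn_group: "comm_group Zn_group"
proof (rule comm_groupI)
  fix x :: "int ^ 'n"
  show "\<exists>y\<in>carrier Zn_group. y \<otimes>\<^bsub>Zn_group\<^esub> x = \<one>\<^bsub>Zn_group\<^esub>"
    by (rule bexI[of _ "- x"]) auto
qed (auto simp: ac_simps)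

interpretation Zn: comm_group "Zn_group :: (int ^ 'n::finite) monoid"
  by (rule Zn_group)

lemma Zn_inv: "inv\<^bsub>Zn_group\<^esub> x = - x"
  by (rule Zn.inv_equality) auto

lemma column_lattice_eq_lat: "column_lattice L = lat (columns L)"
proof
  have "x \<in> lat A" if "x \<in> generate Zn_group A" for x :: "int ^ 'n" and A
    using that by (induction rule: generate.induct)
      (auto simp: Zn_inv intro: lat.intros)
  then show "column_lattice L \<subseteq> lat (columns L)" by (auto simp: column_lattice_def)
  have sub: "subgroup (generate Zn_group A) Zn_group" for A :: "(int ^ 'n) set"
    by (rule Zn.generate_is_subgroup) simp
  have "x \<in> generate Zn_group A" if "x \<in> lat A" for x :: "int ^ 'n" and A
    using that
  proof (induction rule: lat.induct)
    case zero
    show ?case using generate.one[of Zn_group A] by simp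
  next
    case (gen a)
    then show ?case by (rule generate.incl)
  next
    case (uminus x)
    show ?case using subgroup.m_inv_closed[OF sub uminus.IH] by (simp add: Zn_inv)
  next
    case (add x y)
    show ?case using generate.eng[OF add.IH] by simp
  qed
  then show "lat (columns L) \<subseteq> column_lattice L" by (auto simp: column_lattice_def)
qed

context no_face
begin

text \<open>\<open>dot d\<close> vanishes on the lattice and has values in the torsion-free group of
  integers, so torsion lies in its kernel; the converse is
  \<open>torsion_dot_kernel\<close>.\<close>

lemma torsion_subgroup_eq_Tor: "torsion_subgroup (Zn_group Mod lat A) = Tor"
proof -
  have sub: "subgroup (lat A) Zn_group"
    by (rule Zn.subgroupI) (auto simp: Zn_inv intro: lat.intros)
  interpret N: normal "lat A" Zn_group
    by (rule Zn.subgroup_imp_normal[OF sub])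
  have coset: "lat A #>\<^bsub>Zn_group\<^esub> x = coset x" for x
  proof -
    have "(\<exists>l\<in>lat A. y = l + x) \<longleftrightarrow> y - x \<in> lat A" for y
      by (metis add_diff_cancel diff_add_cancel)
    then show ?thesis by (auto simp: r_coset_def coset_def)
  qed
  have carrier: "carrier (Zn_group Mod lat A) = range coset"
    by (auto simp: FactGroup_def RCOSETS_def coset)
  have one: "\<one>\<^bsub>Zn_group Mod lat A\<^esub> = coset 0"
    by (simp add: FactGroup_def coset_def)
  interpret Q: group "Zn_group Mod lat A" by (rule N.factorgroup_is_group)
  have lat_coset: "lat A = coset 0" by (simp add: coset_def)
  have mult: "coset x <#>\<^bsub>Zn_group\<^esub> coset y = coset (x + y)" for x y
    using N.rcos_sum[of x y] by (simp add: coset)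
  have pow: "coset x [^]\<^bsub>Zn_group Mod lat A\<^esub> (n::nat) = coset (int n *s x)" for x n
    by (induction n) (simp_all add: lat_coset mult smult_Suc del: of_nat_Suc)
  have "(\<exists>n::nat. n > 0 \<and> coset x [^]\<^bsub>Zn_group Mod lat A\<^esub> n = coset 0) \<longleftrightarrow> dot d x = 0" for x
  proof
    assume "\<exists>n::nat. n > 0 \<and> coset x [^]\<^bsub>Zn_group Mod lat A\<^esub> n = coset 0"
    then obtain n :: nat where "n > 0" "int n *s x \<in> lat A" by (auto simp: pow coset_eq_iff)
    then show "dot d x = 0" using dot_lat[of "int n *s x"] by simp
  next
    assume "dot d x = 0"
    then obtain n :: nat where "n > 0" "int n *s x \<in> lat A" by (rule torsion_dot_kernel)
    then show "\<exists>n::nat. n > 0 \<and> coset x [^]\<^bsub>Zn_group Mod lat A\<^esub> n = coset 0"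
      by (auto simp: pow coset_eq_iff)
  qed
  then show ?thesis unfolding torsion_subgroup_def carrier one Tor_def by auto
qed

end

text \<open>A nonempty \<open>F\<close> missing an index i but allowed by the condition in
  \<open>face\<close> would have its indicator vector as a nonzero point of V(I, t_i).\<close>

lemma no_face_columns:
  fixes I :: "('n::finite, 'k::field) mvpoly set"
  assumes I: "I = matrix_ideal L" and "\<forall>i. d i > 0" "Gcd (range d) = 1" and hom: "homogeneous_ideal d I"
    and zero: "\<forall>i. zero_set (Idl\<^bsub>class_ring\<^esub> (I \<union> {var_t i})) = {0}"
  shows "no_face (columns L) d"
proof
  show "dot d a = 0" if "a \<in> columns L" for a
    using homogeneous_imp_orthogonal[OF hom[unfolded I matrix_ideal_eq] that] .
  show "F = UNIV" if F: "F \<noteq> {}"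
    and faces: "\<And>a. a \<in> columns L \<Longrightarrow> {i. a $ i > 0} \<subseteq> F \<longleftrightarrow> {i. a $ i < 0} \<subseteq> F" for F
  proof (rule ccontr)
    assume "F \<noteq> UNIV"
    then obtain i where i: "i \<notin> F" by blast
    obtain j where j: "j \<in> F" using F by blast
    let ?x = "(\<chi> i. if i \<in> F then 1 else 0) :: 'k ^ 'n"
    have "eval_mv ?x (var_t i) = (\<Prod>l\<in>UNIV. if l = i then ?x $ i else 1)"
      unfolding var_t_def eval_mv_monom by (rule prod.cong) (auto simp: lookup_single when_def)
    then have "eval_mv ?x (var_t i) = 0" using i by simp
    moreover have "?x \<in> zero_set I"
      unfolding I matrix_ideal_eq by (rule indicator_in_zero_set) (rule faces)
    ultimately have "?x \<in> zero_set (Idl\<^bsub>class_ring\<^esub> (I \<union> {var_t i}))"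
      unfolding zero_set_Idl by (simp add: zero_set_def)
    then have "?x = 0" using zero by simp
    then have "?x $ j = 0" by (simp only: zero_index)
    then show False using j by simp
  qed
qed (use assms in auto)

theorem corollary5p9:
  fixes L :: "int ^ 'm::finite ^ 'n::finite"
    and d :: "'n \<Rightarrow> nat"
    and I :: "('n, 'k::field) mvpoly set"
  assumes "I = matrix_ideal L"
    and "\<forall>i. d i > 0"
    and "Gcd (range d) = 1"
    and "homogeneous_ideal d I"
    and "\<forall>i. zero_set (Idl\<^bsub>class_ring\<^esub> (I \<union> {var_t i})) = {0}"
  shows "quotient_degree I
           = real (Max (range d)) * real (card (torsion_subgroup (Zn_group Mod column_lattice L)))
       \<and> real (Max (range d)) * real (card (torsion_subgroup (Zn_group Mod column_lattice L)))
           = real (Max (range d)) * real_of_int (Delta (CARD('n) - 1) L)"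
proof -
  interpret no_face "columns L" d
    by (rule no_face_columns[OF assms])
  have "torsion_subgroup (Zn_group Mod column_lattice L) = Tor"
    unfolding column_lattice_eq_lat by (rule torsion_subgroup_eq_Tor)
  moreover have "quotient_degree I = real (Max (range d)) * real (card Tor)"
    unfolding assms(1) matrix_ideal_eq by (rule quotient_degree_binomial_ideal)
  moreover have "real (card Tor) = real_of_int (Delta (CARD('n) - 1) L)"
    using card_Tor_eq_Delta[of L] by (metis of_int_of_nat_eq)
  ultimately show ?thesis by simp
qed

end
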